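(* Let the matrices $A_{II}^{(i)},A_{I\Gamma}^{(i)},A_{\Gamma I}^{(i)},A_{\Gamma\Gamma}^{(i)}$, $I_{\Gamma\Gamma}^{(i)}$ ($i\in\{1,\dots,p\}$), $M_{\Gamma\Gamma}$, and the block matrices $A$ and $M$ be as described in the context. Assume that $$\sum_{i=1}^{p}\left|I_{\Gamma\Gamma}^{(i)}-M_{\Gamma\Gamma}^{-1}A_{\Gamma\Gamma}^{(i)}\right|=\left|\sum_{i=1}^{p}\left(I_{\Gamma\Gamma}^{(i)}-M_{\Gamma\Gamma}^{-1}A_{\Gamma\Gamma}^{(i)}\right)\right|.$$ If $$\rho(|I-M^{-1}A|)<1,$$ then the asynchronous primal Schur method is convergent.
   Context: Matrices and vectors have entries in $\mathbb{K}=\mathbb{R}$ or $\mathbb{C}$. $\rho(\cdot)$ is the spectral radius, $|\mathcal A|$ is the entry-wise absolute value of a matrix or vector $\mathcal A$, and $I$ is the identity matrix. Setting (primal Schur domain decomposition with $p$ subdomains and interface $\Gamma$). For each $i\in\{1,\dots,p\}$ one is given matrices $A_{II}^{(i)}$ (square, nonsingular), $A_{I\Gamma}^{(i)}$, $A_{\Gamma I}^{(i)}$, $A_{\Gamma\Gamma}^{(i)}$ and vectors $b_I^{(i)}$, $b_\Gamma^{(i)}$ of compatible sizes; the size of the $I$-blocks may depend on $i$, and the index $\Gamma$ refers to one common finite index set. (When subdomain $i$ touches only a part $\Gamma_l$ of $\Gamma$, these blocks are obtained from local blocks through a Boolean restriction matrix $R^{(i)}_{\Gamma_l\Gamma}$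 from $\Gamma$ to $\Gamma_l$, e.g. $A_{\Gamma\Gamma}^{(i)}={R^{(i)}_{\Gamma_l\Gamma}}^{\mathsf T}A^{(i)}_{\Gamma_l\Gamma_l}R^{(i)}_{\Gamma_l\Gamma}$.) Define $$S_{\Gamma\Gamma}^{(i)}:=A_{\Gamma\Gamma}^{(i)}-A_{\Gamma I}^{(i)}{A_{II}^{(i)}}^{-1}A_{I\Gamma}^{(i)},\quad d_\Gamma^{(i)}:=b_\Gamma^{(i)}-A_{\Gamma I}^{(i)}{A_{II}^{(i)}}^{-1}b_I^{(i)},\quad S_{\Gamma\Gamma}:=\sum_{i=1}^pS_{\Gamma\Gamma}^{(i)},\quad d_\Gamma:=\sum_{i=1}^pd_\Gamma^{(i)}.$$ The interface problem is $S_{\Gamma\Gamma}x_\Gamma=d_\Gamma$. Let $I_{\Gamma\Gamma}$ be the identity matrix on $\Gamma$, let $M_{\Gamma\Gamma}$ be a nonsingular matrix on $\Gamma$, and let $I_{\Gamma\Gamma}^{(1)},\dots,I_{\Gamma\Gamma}^{(p)}$ be matrices on $\Gamma$ with $\sum_{i=1}^pI_{\Gamma\Gamma}^{(i)}=I_{\Gamma\Gamma}$. Block matrices: $$A:=\begin{bmatrix}A_{II}^{(1)}&&0&A_{I\Gamma}^{(1)}\\ &\ddots&&\vdots\\ 0&&A_{II}^{(p)}&A_{I\Gamma}^{(p)}\\ A_{\Gamma I}^{(1)}&\cdots&A_{\Gamma I}^{(p)}&A_{\Gamma\Gamma}\end{bmatrix},\quad A_{\Gamma\Gamma}:=\sum_{i=1}^pA_{\Gamma\Gamma}^{(i)},\qquad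 M:=\begin{bmatrix}A_{II}^{(1)}&&0&0\\ &\ddots&&\vdots\\ 0&&A_{II}^{(p)}&0\\ 0&\cdots&0&M_{\Gamma\Gamma}\end{bmatrix}.$$ Asynchronous primal Schur method. Given initial vectors $x_\Gamma^{(i),0}$ ($i\in\{1,\dots,p\}$), sets $P^{(k)}\subseteq\{1,\dots,p\}$ ($k\in\mathbb{N}$) and maps $\tau_j^i:\mathbb{N}\to\mathbb{N}$ ($i,j\in\{1,\dots,p\}$) with $\tau_j^i(k)\le k$, such that (a) for every $i$, the set $\{k\in\mathbb{N}: i\in P^{(k)}\}$ is infinite, and (b) for all $i,j$, $\lim_{k\to\infty}\tau_j^i(k)=+\infty$, the method generates, for $k\in\mathbb{N}$ and $i\in\{1,\dots,p\}$, $$y_\Gamma^{(i),k}:=I_{\Gamma\Gamma}^{(i)}x_\Gamma^{(i),k}+M_{\Gamma\Gamma}^{-1}\left(d_\Gamma^{(i)}-S_{\Gamma\Gamma}^{(i)}x_\Gamma^{(i),k}\right),\qquad x_\Gamma^{(i),k+1}=\begin{cases}\sum_{j=1}^py_\Gamma^{(j),\tau_j^i(k)},& i\in P^{(k)},\\ x_\Gamma^{(i),k},& i\notin P^{(k)}.\end{cases}$$ The method is called convergent if, for all choices of the initial vectors $x_\Gamma^{(i),0}$, of sets $P^{(k)}\subseteq\{1,\dots,p\}$ such that $\{k\in\mathbb{N}: i\in P^{(k)}\}$ is infinite for every $i$, and of maps $\tau_j^i:\mathbb{N}\to\mathbb{N}$ such that $\tau_j^i(k)\le k$ for all $k$ and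 $\lim_{k\to\infty}\tau_j^i(k)=+\infty$ for all $i,j$, each sequence $(x_\Gamma^{(i),k})_{k}$, $i\in\{1,\dots,p\}$, converges as $k\to\infty$ to the solution $x_\Gamma$ of $S_{\Gamma\Gamma}x_\Gamma=d_\Gamma$. *)

theory Defs
  imports "Jordan_Normal_Form.Spectral_Radius" "Jordan_Normal_Form.Gauss_Jordan_Elimination"
begin

text \<open>Scalars range over the class \<open>real_normed_field\<close>: besides its instances \<open>real\<close> and \<open>complex\<close>
  there are, by the Gelfand--Mazur theorem, no others up to isometric isomorphism.\<close>

(* the value of inv_mat is only meaningful for invertible arguments *)
definition inv_mat :: "'a::field mat \<Rightarrow> 'a mat" where
  "inv_mat A = the (mat_inverse A)"

definition abs_mat :: "'a::real_normed_field mat \<Rightarrow> real mat" where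
  "abs_mat A = map_mat norm A"

definition mat_sum :: "nat \<Rightarrow> nat \<Rightarrow> ('b \<Rightarrow> 'a::comm_monoid_add mat) \<Rightarrow> 'b set \<Rightarrow> 'a mat" where
  "mat_sum nr nc F J = mat nr nc (\<lambda>ab. \<Sum>j\<in>J. F j $$ ab)"

definition block_col :: "nat \<Rightarrow> 'a::zero mat list \<Rightarrow> 'a mat" where
  "block_col nc Bs = foldr (@\<^sub>r) Bs (0\<^sub>m 0 nc)"

definition block_row :: "nat \<Rightarrow> 'a::zero mat list \<Rightarrow> 'a mat" where
  "block_row nr Bs = transpose_mat (block_col nr (map transpose_mat Bs))"

text \<open>Subdomains are numbered \<open>1, \<dots>, p\<close>, the interface has \<open>m\<close> unknowns, and subdomain
  \<open>i\<close> has its own number of interior unknowns, read off from the size of \<open>AII i\<close>.\<close>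

definition global_mat ::
  "nat \<Rightarrow> nat \<Rightarrow> (nat \<Rightarrow> 'a mat) \<Rightarrow> (nat \<Rightarrow> 'a mat) \<Rightarrow> (nat \<Rightarrow> 'a mat) \<Rightarrow>
    (nat \<Rightarrow> 'a::comm_monoid_add mat) \<Rightarrow> 'a mat" where
  "global_mat p m AII AIG AGI AGG =
     four_block_mat
       (diag_block_mat (map AII [1..<Suc p]))  (block_col m (map AIG [1..<Suc p]))
       (block_row m (map AGI [1..<Suc p]))     (mat_sum m m AGG {1..p})"

definition splitting_mat :: "nat \<Rightarrow> (nat \<Rightarrow> 'a mat) \<Rightarrow> 'a::zero mat \<Rightarrow> 'a mat" where
  "splitting_mat p AII MGG =
     (let D = diag_block_mat (map AII [1..<Suc p]) in
      four_block_mat D (0\<^sub>m (dim_row D) (dim_col MGG)) (0\<^sub>m (dim_row MGG) (dim_col D)) MGG)"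

definition schur_mat :: "'a mat \<Rightarrow> 'a mat \<Rightarrow> 'a mat \<Rightarrow> 'a::field mat \<Rightarrow> 'a mat" where
  "schur_mat A_II A_IG A_GI A_GG = A_GG - A_GI * inv_mat A_II * A_IG"

definition schur_rhs :: "'a mat \<Rightarrow> 'a mat \<Rightarrow> 'a vec \<Rightarrow> 'a::field vec \<Rightarrow> 'a vec" where
  "schur_rhs A_II A_GI b_I b_G = b_G - (A_GI * inv_mat A_II) *\<^sub>v b_I"

definition admissible_updates :: "nat \<Rightarrow> (nat \<Rightarrow> nat set) \<Rightarrow> bool" where
  "admissible_updates p P \<longleftrightarrow>
     (\<forall>k. P k \<subseteq> {1..p}) \<and> (\<forall>i\<in>{1..p}. infinite {k. i \<in> P k})"

definition admissible_delays :: "nat \<Rightarrow> (nat \<Rightarrow> nat \<Rightarrow> nat \<Rightarrow> nat) \<Rightarrow> bool" where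
  "admissible_delays p \<tau> \<longleftrightarrow>
     (\<forall>i\<in>{1..p}. \<forall>j\<in>{1..p}. (\<forall>k. \<tau> i j k \<le> k) \<and> filterlim (\<tau> i j) at_top sequentially)"

text \<open>Below, \<open>S i\<close> and \<open>d i\<close> stand for the local Schur complement and condensed right-hand
  side of subdomain \<open>i\<close>.\<close>

definition local_update ::
  "'a mat \<Rightarrow> (nat \<Rightarrow> 'a mat) \<Rightarrow> (nat \<Rightarrow> 'a mat) \<Rightarrow> (nat \<Rightarrow> 'a::field vec) \<Rightarrow>
    nat \<Rightarrow> 'a vec \<Rightarrow> 'a vec" where
  "local_update MGG IG S d i x = IG i *\<^sub>v x + inv_mat MGG *\<^sub>v (d i - S i *\<^sub>v x)"

text \<open>\<open>x i k\<close> is the \<open>k\<close>-th iterate of subdomain \<open>i\<close> and \<open>\<tau> i j k\<close> is the index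
  $\tau_j^i(k)$ of the iterate of subdomain \<open>j\<close> used by subdomain \<open>i\<close>. Since \<open>\<tau> i j k \<le> k\<close>
  for admissible delays, the relation below determines
  \<open>x i\<close> uniquely, for every \<open>i \<in> {1..p}\<close>, from the initial vectors \<open>x0\<close>.\<close>

definition async_iterates ::
  "nat \<Rightarrow> nat \<Rightarrow> 'a mat \<Rightarrow> (nat \<Rightarrow> 'a mat) \<Rightarrow> (nat \<Rightarrow> 'a mat) \<Rightarrow> (nat \<Rightarrow> 'a::field vec) \<Rightarrow>
    (nat \<Rightarrow> 'a vec) \<Rightarrow> (nat \<Rightarrow> nat set) \<Rightarrow> (nat \<Rightarrow> nat \<Rightarrow> nat \<Rightarrow> nat) \<Rightarrow>
    (nat \<Rightarrow> nat \<Rightarrow> 'a vec) \<Rightarrow> bool" where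
  "async_iterates p m MGG IG S d x0 P \<tau> x \<longleftrightarrow>
     (\<forall>i\<in>{1..p}. x i 0 = x0 i \<and>
       (\<forall>k. x i (Suc k) =
         (if i \<in> P k
          then finsum_vec TYPE('a) m (\<lambda>j. local_update MGG IG S d j (x j (\<tau> i j k))) {1..p}
          else x i k)))"

text \<open>Convergence in the finite-dimensional space of vectors of length \<open>m\<close> is componentwise.\<close>

definition vec_tendsto :: "nat \<Rightarrow> (nat \<Rightarrow> 'a::topological_space vec) \<Rightarrow> 'a vec \<Rightarrow> bool" where
  "vec_tendsto m u v \<longleftrightarrow> (\<forall>a<m. (\<lambda>k. u k $ a) \<longlonglongrightarrow> v $ a)"

text \<open>Convergence of the method includes that the interface problem has exactly one solution.\<close>

definition async_schur_convergent ::
  "nat \<Rightarrow> nat \<Rightarrow> 'a mat \<Rightarrow> (nat \<Rightarrow> 'a mat) \<Rightarrow> (nat \<Rightarrow> 'a mat) \<Rightarrow>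
    (nat \<Rightarrow> 'a::real_normed_field vec) \<Rightarrow> bool" where
  "async_schur_convergent p m MGG IG S d \<longleftrightarrow>
     (\<exists>xs \<in> carrier_vec m.
        mat_sum m m S {1..p} *\<^sub>v xs = finsum_vec TYPE('a) m d {1..p} \<and>
        (\<forall>z \<in> carrier_vec m.
           mat_sum m m S {1..p} *\<^sub>v z = finsum_vec TYPE('a) m d {1..p} \<longrightarrow> z = xs) \<and>
        (\<forall>x0 P \<tau> x.
           (\<forall>i\<in>{1..p}. x0 i \<in> carrier_vec m) \<longrightarrow>
           admissible_updates p P \<longrightarrow> admissible_delays p \<tau> \<longrightarrow>
           async_iterates p m MGG IG S d x0 P \<tau> x \<longrightarrow>
           (\<forall>i\<in>{1..p}. vec_tendsto m (x i) xs)))"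

end

theory Submission
  imports Defs
begin

text \<open>
  Let \<open>F i = IG i - MGG\<^sup>-\<^sup>1 AGG i\<close>, \<open>B i = (AII i)\<^sup>-\<^sup>1 AIG i\<close> and \<open>C i = MGG\<^sup>-\<^sup>1 AGI i\<close>. Subdomain \<open>i\<close> contributes
  to the asynchronous iteration the matrix \<open>IG i - MGG\<^sup>-\<^sup>1 S i = F i + C i B i\<close>. The method converges as
  soon as a positive weight \<open>v\<close> on the interface and some \<open>\<gamma> < 1\<close> satisfy
  \<open>(\<Sum>i. \<bar>F i\<bar> + \<bar>C i\<bar> \<bar>B i\<bar>) v \<le> \<gamma> v\<close>: in the maximum norm weighted by \<open>v\<close>, the error after an
  update is then at most \<open>\<gamma>\<close> times the largest error among the values it reads, however
  old these are and from whichever subdomain they come. The lemma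
  \<open>nested_sets_asynchronous_convergence\<close> turns this into convergence, and the same contraction makes the
  interface problem uniquely solvable (\<open>async_schur_convergentI\<close>).

  The weight comes from the global matrix. In block form (\<open>iteration_matrix_blocks\<close>),
  \<open>\<bar>I - M\<^sup>-\<^sup>1 A\<bar>\<close> has a zero interior block, the column of all \<open>\<bar>B i\<bar>\<close> to the right of it, the row of all
  \<open>\<bar>C i\<bar>\<close> below it, and the interface block \<open>\<bar>\<Sum>i. F i\<bar>\<close>, which by assumption is \<open>\<Sum>i. \<bar>F i\<bar>\<close>. As the
  spectral radius of this nonnegative matrix is below one, it has a positive weight \<open>(u, v)\<close> that it
  shrinks by a factor \<open>\<gamma> < 1\<close> (\<open>subinvariant_weight\<close>). Inserting the interior rows
  \<open>\<bar>B i\<bar> v \<le> \<gamma> u i\<close> into the interface rows eliminates \<open>u\<close> and leaves the required inequality for \<open>v\<close>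
  (\<open>four_block_subinvariant\<close>).
\<close>

section \<open>Asynchronous iterations through nested sets\<close>

text \<open>Bertsekas' argument. Once all iterates lie in \<open>X n\<close>, only finitely many later updates can
  still read a value from before that time, because the delays tend to infinity. Every further update
  lands in \<open>X (Suc n)\<close>, and every component is updated at least once more, after which it stays there.\<close>
lemma nested_sets_asynchronous_convergence:
  fixes x :: "'i \<Rightarrow> nat \<Rightarrow> 'b" and X :: "nat \<Rightarrow> 'b set"
  assumes fin: "finite J"
    and nested: "\<And>n. X (Suc n) \<subseteq> X n"
    and contr: "\<And>n y i. i \<in> J \<Longrightarrow> (\<And>j. j \<in> J \<Longrightarrow> y j \<in> X n) \<Longrightarrow> F i y \<in> X (Suc n)"
    and init: "\<And>i. i \<in> J \<Longrightarrow> x i 0 \<in> X 0"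
    and upd: "\<And>i k. i \<in> J \<Longrightarrow> i \<in> P k \<Longrightarrow> x i (Suc k) = F i (\<lambda>j. x j (\<tau> i j k))"
    and keep: "\<And>i k. i \<in> J \<Longrightarrow> i \<notin> P k \<Longrightarrow> x i (Suc k) = x i k"
    and often: "\<And>i. i \<in> J \<Longrightarrow> infinite {k. i \<in> P k}"
    and causal: "\<And>i j k. i \<in> J \<Longrightarrow> j \<in> J \<Longrightarrow> \<tau> i j k \<le> k"
    and fresh: "\<And>i j. i \<in> J \<Longrightarrow> j \<in> J \<Longrightarrow> filterlim (\<tau> i j) at_top sequentially"
  shows "\<exists>K. \<forall>k\<ge>K. \<forall>i\<in>J. x i k \<in> X n"
proof (induction n)
  case 0
  have "\<forall>i\<in>J. x i k \<in> X 0" for k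
  proof (induction k rule: less_induct)
    case (less k)
    show ?case
    proof (cases k)
      case 0
      then show ?thesis using init by simp
    next
      case (Suc l)
      show ?thesis
      proof
        fix i assume i: "i \<in> J"
        show "x i k \<in> X 0"
        proof (cases "i \<in> P l")
          case True
          have "x j (\<tau> i j l) \<in> X 0" if "j \<in> J" for j
            using less.IH[of "\<tau> i j l"] causal[OF i that, of l] that Suc by auto
          then have "F i (\<lambda>j. x j (\<tau> i j l)) \<in> X (Suc 0)"
            by (intro contr[OF i])
          then show ?thesis using nested upd[OF i True] Suc by auto
        next
          case False
          then show ?thesis using keep[OF i False] less.IH[of l] i Suc by simp
        qed
      qed
    qed
  qed
  then show ?case by blast
next
  case (Suc n)
  \<comment> \<open>From \<open>K\<close> on the iterates are in \<open>X n\<close>; from \<open>L\<close> on nothing older than \<open>K\<close> is read.\<close>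
  then obtain K where K: "\<And>k i. k \<ge> K \<Longrightarrow> i \<in> J \<Longrightarrow> x i k \<in> X n" by blast
  have "eventually (\<lambda>k. \<forall>i\<in>J. \<forall>j\<in>J. \<tau> i j k \<ge> K) sequentially"
    using fresh by (intro eventually_ball_finite[OF fin] ballI)
      (auto simp: filterlim_at_top intro: eventually_ball_finite[OF fin])
  then obtain L where L: "\<And>k i j. k \<ge> L \<Longrightarrow> i \<in> J \<Longrightarrow> j \<in> J \<Longrightarrow> \<tau> i j k \<ge> K"
    unfolding eventually_sequentially by blast
  have new: "x i (Suc k) \<in> X (Suc n)" if "i \<in> J" "i \<in> P k" "k \<ge> L" for i k
    unfolding upd[OF that(1,2)] using that K L by (intro contr) auto
  have "\<exists>k\<ge>L. i \<in> P k" if "i \<in> J" for i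
    using often[OF that] unfolding infinite_nat_iff_unbounded_le by auto
  then obtain t where t: "\<And>i. i \<in> J \<Longrightarrow> t i \<ge> L \<and> i \<in> P (t i)" by metis
  have stay: "x i k \<in> X (Suc n)" if i: "i \<in> J" and k: "k \<ge> Suc (t i)" for i k
    using k
  proof (induction k rule: dec_induct)
    case base
    then show ?case using new[of i "t i"] t[OF i] i by blast
  next
    case (step k)
    then show ?case
      using new[OF i, of k] keep[OF i, of k] t[OF i] by (cases "i \<in> P k") auto
  qed
  obtain K' where K': "\<And>i. i \<in> J \<Longrightarrow> Suc (t i) \<le> K'"
    using finite_nat_set_iff_bounded_le[of "(\<lambda>i. Suc (t i)) ` J"] fin by auto
  show ?case using stay K' order_trans by blast
qed

section \<open>A subinvariant weight for a nonnegative matrix of spectral radius below one\<close>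

lemma smult_mat_pow:
  fixes A :: "'a::comm_ring_1 mat"
  assumes A: "A \<in> carrier_mat N N"
  shows "(r \<cdot>\<^sub>m A) ^\<^sub>m k = r ^ k \<cdot>\<^sub>m (A ^\<^sub>m k)"
proof (induction k)
  case (Suc k)
  have Ak: "A ^\<^sub>m k \<in> carrier_mat N N" using A by simp
  show ?case
    using A Ak by (auto simp: Suc mult_smult_distrib[OF _ A] mult_smult_assoc_mat[OF Ak] ac_simps)
qed (use A in auto)

lemma spectral_radius_smult_le:
  assumes A: "A \<in> carrier_mat N N" and N: "N > 0" and r: "r > 0"
  shows "spectral_radius (complex_of_real r \<cdot>\<^sub>m A) \<le> r * spectral_radius A"
proof -
  let ?B = "complex_of_real r \<cdot>\<^sub>m A"
  have B: "?B \<in> carrier_mat N N" using A by simp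
  obtain l where l: "eigenvalue ?B l" and eq: "spectral_radius ?B = norm l"
    using spectral_radius_mem_max(1)[OF B N] by (auto simp: spectrum_def)
  obtain v where v: "v \<in> carrier_vec N" "v \<noteq> 0\<^sub>v N" "?B *\<^sub>v v = l \<cdot>\<^sub>v v"
    using l B unfolding eigenvalue_def eigenvector_def by auto
  have "A *\<^sub>v v = (l / r) \<cdot>\<^sub>v v"
  proof (rule eq_vecI)
    fix a assume a: "a < dim_vec ((l / r) \<cdot>\<^sub>v v)"
    have "(?B *\<^sub>v v) $ a = (l \<cdot>\<^sub>v v) $ a" using v(3) by simp
    then have "r * (A *\<^sub>v v) $ a = l * v $ a"
      using a A v(1) by (simp add: scalar_prod_def sum_distrib_left mult.assoc)
    then show "(A *\<^sub>v v) $ a = ((l / r) \<cdot>\<^sub>v v) $ a"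
      using r a v(1) by (simp add: field_simps)
  qed (use A v in auto)
  then have "eigenvalue A (l / r)"
    using v A unfolding eigenvalue_def eigenvector_def by auto
  then have "norm (l / r) \<le> spectral_radius A"
    using spectral_radius_mem_max(2)[OF A N] by (auto simp: spectrum_def)
  then show ?thesis using r eq by (simp add: norm_divide field_simps)
qed

text \<open>Spectral radius below one bounds the powers of a matrix by a constant. To turn boundedness into
  decay, this is applied to a multiple \<open>r A\<close> with \<open>r > 1\<close> whose spectral radius is still below one.\<close>
lemma mat_pow_tendsto_0:
  assumes A: "A \<in> carrier_mat N N" and sr: "spectral_radius A < 1" and a: "a < N" and b: "b < N"
  shows "(\<lambda>k. (A ^\<^sub>m k) $$ (a, b)) \<longlonglongrightarrow> 0"
proof -
  have N: "N > 0" using a by simp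
  define s where "s = spectral_radius A"
  have s: "0 \<le> s" "s < 1"
    using spectral_radius_mem_max(1)[OF A N] sr by (auto simp: s_def)
  \<comment> \<open>A number strictly between 1 and the reciprocal of \<open>s\<close> that also makes sense for \<open>s = 0\<close>.\<close>
  define r where "r = 2 / (1 + s)"
  have r: "r > 1" "r * s < 1" using s by (auto simp: r_def field_simps)
  let ?B = "complex_of_real r \<cdot>\<^sub>m A"
  have "spectral_radius ?B < 1"
    using spectral_radius_smult_le[OF A N, of r] r by (simp add: s_def)
  then obtain c where "\<And>k. norm_bound (?B ^\<^sub>m k) c"
    using spectral_radius_jnf_norm_bound_less_1_upper_triangular[of ?B N] A by auto
  then have c: "norm ((?B ^\<^sub>m k) $$ (a, b)) \<le> c" for k
    using A a b unfolding norm_bound_def by simp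
  have bound: "norm ((A ^\<^sub>m k) $$ (a, b)) \<le> norm (inverse r ^ k) * c" for k
  proof -
    have "r ^ k * norm ((A ^\<^sub>m k) $$ (a, b)) \<le> c"
      using c[of k] A a b r by (simp add: smult_mat_pow[OF A] norm_mult norm_power)
    moreover have "norm (inverse r ^ k) = 1 / r ^ k"
      using r by (simp add: norm_power inverse_eq_divide power_one_over)
    ultimately show ?thesis using r by (simp add: pos_le_divide_eq mult.commute)
  qed
  have "(\<lambda>k. inverse r ^ k) \<longlonglongrightarrow> 0"
    using r by (intro LIMSEQ_realpow_zero) (auto intro: inverse_less_1_iff[THEN iffD2])
  then show ?thesis
    by (rule tendsto_0_le[where K = c]) (intro always_eventually allI bound)
qed

text \<open>The weight is a partial sum of the Neumann series, \<open>w = (1 + T + \<dots> + T^K) e\<close> with \<open>e\<close> the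
  all-ones vector: then \<open>T w = w - e + T^(K+1) e\<close>, which is below \<open>w - e/2\<close> once \<open>T^(K+1) e\<close> is
  below \<open>e/2\<close>. This is a substitute for a Perron vector; in contrast to that vector it is positive in
  every component even if \<open>T\<close> is reducible.\<close>
lemma subinvariant_weight:
  fixes T :: "real mat"
  assumes T: "T \<in> carrier_mat N N"
    and nonneg: "\<And>a b. a < N \<Longrightarrow> b < N \<Longrightarrow> T $$ (a, b) \<ge> 0"
    and sr: "spectral_radius (map_mat complex_of_real T) < 1"
  obtains w \<gamma> where "w \<in> carrier_vec N" "\<And>a. a < N \<Longrightarrow> w $ a > 0" "0 \<le> \<gamma>" "\<gamma> < 1"
    "T *\<^sub>v w \<le> \<gamma> \<cdot>\<^sub>v w"
proof -
  define e :: "real vec" where "e = vec N (\<lambda>_. 1)"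
  have e: "e \<in> carrier_vec N" by (simp add: e_def)
  \<comment> \<open>\<open>u k\<close> is the sum of the first \<open>k\<close> terms, written as a Horner scheme.\<close>
  define u where "u k = ((\<lambda>y. e + T *\<^sub>v y) ^^ k) (0\<^sub>v N)" for k
  have u_0: "u 0 = 0\<^sub>v N" and u_Suc: "u (Suc k) = e + T *\<^sub>v u k" for k
    by (simp_all add: u_def)
  have u: "u k \<in> carrier_vec N" for k
    by (induction k) (use T e in \<open>auto simp: u_0 u_Suc\<close>)
  have u_nonneg: "u k $ a \<ge> 0" if "a < N" for k a
    using that
  proof (induction k arbitrary: a)
    case (Suc k)
    then show ?case
      using T u[of k] nonneg
      by (auto simp: u_Suc e_def scalar_prod_def intro!: add_nonneg_nonneg sum_nonneg)
  qed (auto simp: u_0)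
  have pow: "T ^\<^sub>m Suc k = T * T ^\<^sub>m k" for k
  proof (induction k)
    case (Suc k)
    have "T ^\<^sub>m Suc (Suc k) = (T * T ^\<^sub>m k) * T" using Suc by simp
    then show ?case using T by (simp add: assoc_mult_mat[of T N N _ N T N])
  qed (use T in auto)
  have step: "u (Suc k) = u k + T ^\<^sub>m k *\<^sub>v e" for k
  proof (induction k)
    case (Suc k)
    have Tk: "T ^\<^sub>m k \<in> carrier_mat N N" using T by simp
    have "u (Suc (Suc k)) = e + T *\<^sub>v (u k + T ^\<^sub>m k *\<^sub>v e)"
      by (subst u_Suc) (simp add: Suc)
    also have "\<dots> = (e + T *\<^sub>v u k) + (T * T ^\<^sub>m k) *\<^sub>v e"
      using T e u[of k] mult_mat_vec_carrier[OF Tk e]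
      unfolding assoc_mult_mat_vec[OF T Tk e]
        mult_add_distrib_mat_vec[OF T u[of k] mult_mat_vec_carrier[OF Tk e]]
      by (intro assoc_add_vec[symmetric, of _ N] mult_mat_vec_carrier[OF T])
    finally show ?case by (simp only: u_Suc pow)
  qed (use T e in \<open>auto simp: u_0 u_Suc\<close>)
  have "(\<lambda>k. (T ^\<^sub>m k *\<^sub>v e) $ a) \<longlonglongrightarrow> 0" if a: "a < N" for a
  proof -
    have lim: "(\<lambda>k. (T ^\<^sub>m k) $$ (a, b)) \<longlonglongrightarrow> 0" if b: "b < N" for b
    proof -
      have "(\<lambda>k. (map_mat complex_of_real T ^\<^sub>m k) $$ (a, b)) \<longlonglongrightarrow> 0"
        using T sr a b by (intro mat_pow_tendsto_0) auto
      then have "(\<lambda>k. complex_of_real ((T ^\<^sub>m k) $$ (a, b))) \<longlonglongrightarrow> 0"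
        using T a b by (simp add: of_real_hom.mat_hom_pow[OF T, symmetric])
      from tendsto_Re[OF this] show ?thesis by simp
    qed
    have "(T ^\<^sub>m k *\<^sub>v e) $ a = (\<Sum>b<N. (T ^\<^sub>m k) $$ (a, b))" for k
      using T a by (simp add: e_def scalar_prod_def atLeast0LessThan)
    then show ?thesis using tendsto_sum[of "{..<N}", OF lim] by simp
  qed
  then have "eventually (\<lambda>k. (T ^\<^sub>m k *\<^sub>v e) $ a < 1/2) sequentially" if "a < N" for a
    using that by (intro order_tendstoD(2)[of _ "0::real"]) auto
  then have "eventually (\<lambda>k. \<forall>a\<in>{..<N}. (T ^\<^sub>m k *\<^sub>v e) $ a < 1/2) sequentially"
    by (intro eventually_ball_finite) auto
  then obtain K where K: "\<And>k a. k \<ge> K \<Longrightarrow> a < N \<Longrightarrow> (T ^\<^sub>m k *\<^sub>v e) $ a < 1/2"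
    unfolding eventually_sequentially by auto
  define w where "w = u (Suc K)"
  have w: "w \<in> carrier_vec N" unfolding w_def by (rule u)
  have w_pos: "w $ a > 0" if "a < N" for a
  proof -
    have "(T *\<^sub>v u K) $ a = (\<Sum>b=0..<N. T $$ (a, b) * u K $ b)"
      using T u[of K] that by (simp add: scalar_prod_def)
    also have "\<dots> \<ge> 0"
      using nonneg[OF that] u_nonneg by (intro sum_nonneg mult_nonneg_nonneg) auto
    finally show ?thesis using T that by (simp add: w_def u_Suc e_def)
  qed
  have Tw: "(T *\<^sub>v w) $ a \<le> w $ a - 1/2" if a: "a < N" for a
  proof -
    have "(e + T *\<^sub>v w) $ a = (w + T ^\<^sub>m Suc K *\<^sub>v e) $ a"
      unfolding w_def u_Suc[of "Suc K", symmetric] step[of "Suc K"] ..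
    moreover have "(T ^\<^sub>m Suc K *\<^sub>v e) $ a < 1/2" using K[of "Suc K"] a by simp
    ultimately show ?thesis using a T w by (simp add: e_def del: pow_mat.simps)
  qed
  \<comment> \<open>The uniform gain 1/2 becomes a factor below 1 through any upper bound \<open>W\<close> of the weight.\<close>
  define W where "W = 1 + (\<Sum>a<N. w $ a)"
  have W: "W \<ge> 1" "\<And>a. a < N \<Longrightarrow> w $ a \<le> W"
  proof -
    have "(\<Sum>a<N. w $ a) \<ge> 0" using w_pos by (intro sum_nonneg) (simp add: less_imp_le)
    then show "W \<ge> 1" by (simp add: W_def)
    fix a assume "a < N"
    then have "w $ a \<le> (\<Sum>a<N. w $ a)"
      using w_pos by (intro member_le_sum) (auto simp: less_imp_le)
    then show "w $ a \<le> W" by (simp add: W_def)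
  qed
  have "T *\<^sub>v w \<le> (1 - 1 / (2 * W)) \<cdot>\<^sub>v w"
    unfolding less_eq_vec_def
  proof (intro conjI allI impI)
    fix a assume "a < dim_vec ((1 - 1 / (2 * W)) \<cdot>\<^sub>v w)"
    then have a: "a < N" using w by simp
    have "w $ a / (2 * W) \<le> 1/2" using W(1) W(2)[OF a] by (simp add: field_simps)
    then show "(T *\<^sub>v w) $ a \<le> ((1 - 1 / (2 * W)) \<cdot>\<^sub>v w) $ a"
      using Tw[OF a] a w by (simp add: algebra_simps)
  qed (use T w in auto)
  moreover have "0 \<le> 1 - 1 / (2 * W)" "1 - 1 / (2 * W) < 1"
    using W(1) by (simp_all add: field_simps)
  ultimately show ?thesis using that[OF w w_pos] by blast
qed

section \<open>Inverses, sums and blocks of matrices\<close>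

lemma inv_mat_invertible:
  assumes A: "A \<in> carrier_mat n n" and inv: "invertible_mat A"
  shows "inv_mat A \<in> carrier_mat n n" "inv_mat A * A = 1\<^sub>m n" "A * inv_mat A = 1\<^sub>m n"
proof -
  obtain B where B: "A * B = 1\<^sub>m n" "B * A = 1\<^sub>m (dim_row B)"
    using A inv unfolding invertible_mat_def inverts_mat_def by auto
  have "dim_col B = n" "dim_row B = n"
    using arg_cong[OF B(1), of dim_col] arg_cong[OF B(2), of dim_col] A by auto
  then have "A \<in> Units (ring_mat TYPE('a) n ())"
    using A B by (auto simp: Units_def ring_mat_def intro!: bexI[of _ B])
  then obtain C where "mat_inverse A = Some C"
    using mat_inverse(1)[OF A, of "()"] by (cases "mat_inverse A") auto
  then show "inv_mat A \<in> carrier_mat n n" "inv_mat A * A = 1\<^sub>m n" "A * inv_mat A = 1\<^sub>m n"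
    using mat_inverse(2)[OF A] by (auto simp: inv_mat_def)
qed

lemma inv_mat_eqI:
  assumes A: "A \<in> carrier_mat n n" and B: "B \<in> carrier_mat n n" and BA: "B * A = 1\<^sub>m n"
  shows "inv_mat A = B"
proof -
  have AB: "A * B = 1\<^sub>m n" using mat_mult_left_right_inverse[OF B A BA] .
  then have "invertible_mat A"
    using A B BA unfolding invertible_mat_def inverts_mat_def by auto
  note C = inv_mat_invertible[OF A this]
  have "B = (inv_mat A * A) * B" using B C by simp
  also have "\<dots> = inv_mat A" using assoc_mult_mat[OF C(1) A B] AB C(1) by simp
  finally show ?thesis ..
qed

lemma mat_sum_carrier [simp]: "mat_sum nr nc F J \<in> carrier_mat nr nc"
  by (simp add: mat_sum_def)

lemma mat_sum_insert:
  assumes "finite J" "i \<notin> J" "F i \<in> carrier_mat nr nc"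
  shows "mat_sum nr nc F (insert i J) = F i + mat_sum nr nc F J"
  using assms by (intro eq_matI) (auto simp: mat_sum_def)

lemma mat_sum_mult_vec_index:
  fixes F :: "'b \<Rightarrow> 'a::comm_semiring_1 mat"
  assumes F: "\<And>j. j \<in> J \<Longrightarrow> F j \<in> carrier_mat nr nc" and z: "z \<in> carrier_vec nc" and a: "a < nr"
  shows "(mat_sum nr nc F J *\<^sub>v z) $ a = (\<Sum>j\<in>J. (F j *\<^sub>v z) $ a)"
proof -
  have "(mat_sum nr nc F J *\<^sub>v z) $ a = (\<Sum>b=0..<nc. \<Sum>j\<in>J. F j $$ (a, b) * z $ b)"
    using z a by (simp add: mat_sum_def scalar_prod_def sum_distrib_right)
  also have "\<dots> = (\<Sum>j\<in>J. \<Sum>b=0..<nc. F j $$ (a, b) * z $ b)"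
    by (rule sum.swap)
  also have "\<dots> = (\<Sum>j\<in>J. (F j *\<^sub>v z) $ a)"
    using F z a by (intro sum.cong refl) (auto simp: scalar_prod_def dest!: F)
  finally show ?thesis .
qed

lemma mult_mat_sum:
  fixes F :: "'b \<Rightarrow> 'a::comm_semiring_1 mat"
  assumes B: "B \<in> carrier_mat k nr" and F: "\<And>j. j \<in> J \<Longrightarrow> F j \<in> carrier_mat nr nc"
  shows "B * mat_sum nr nc F J = mat_sum k nc (\<lambda>j. B * F j) J"
proof (rule eq_matI)
  fix a b assume ab: "a < dim_row (mat_sum k nc (\<lambda>j. B * F j) J)" "b < dim_col (mat_sum k nc (\<lambda>j. B * F j) J)"
  then have ab: "a < k" "b < nc" by (auto simp: mat_sum_def)
  have "(B * mat_sum nr nc F J) $$ (a, b) = (\<Sum>c=0..<nr. \<Sum>j\<in>J. B $$ (a, c) * F j $$ (c, b))"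
    using B ab by (simp add: mat_sum_def scalar_prod_def sum_distrib_left)
  also have "\<dots> = (\<Sum>j\<in>J. \<Sum>c=0..<nr. B $$ (a, c) * F j $$ (c, b))"
    by (rule sum.swap)
  also have "\<dots> = mat_sum k nc (\<lambda>j. B * F j) J $$ (a, b)"
    using F B ab by (auto simp: scalar_prod_def mat_sum_def intro!: sum.cong dest!: F)
  finally show "(B * mat_sum nr nc F J) $$ (a, b) = mat_sum k nc (\<lambda>j. B * F j) J $$ (a, b)" .
qed (use B in \<open>auto simp: mat_sum_def\<close>)

lemma mat_sum_diff:
  fixes F G :: "'b \<Rightarrow> 'a::ab_group_add mat"
  assumes "\<And>j. j \<in> J \<Longrightarrow> F j \<in> carrier_mat nr nc" "\<And>j. j \<in> J \<Longrightarrow> G j \<in> carrier_mat nr nc"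
  shows "mat_sum nr nc (\<lambda>j. F j - G j) J = mat_sum nr nc F J - mat_sum nr nc G J"
  using assms
  by (intro eq_matI) (auto simp: mat_sum_def sum_subtractf[symmetric] intro!: sum.cong dest!: assms)

lemma block_col_simps [simp]: "block_col nc [] = 0\<^sub>m 0 nc"
  "block_col nc (B # Bs) = B @\<^sub>r block_col nc Bs"
  by (simp_all add: block_col_def)

lemma block_col_carrier:
  "(\<And>i. i \<in> set is \<Longrightarrow> B i \<in> carrier_mat (n i) nc) \<Longrightarrow>
    block_col nc (map B is) \<in> carrier_mat (sum_list (map n is)) nc"
  by (induction "is") auto

lemma block_row_carrier:
  assumes "\<And>i. i \<in> set is \<Longrightarrow> C i \<in> carrier_mat nr (n i)"
  shows "block_row nr (map C is) \<in> carrier_mat nr (sum_list (map n is))"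
  using block_col_carrier[of "is" "\<lambda>i. transpose_mat (C i)" n nr] assms
  by (simp add: block_row_def o_def)

lemma diag_block_mat_carrier:
  "(\<And>i. i \<in> set is \<Longrightarrow> A i \<in> carrier_mat (n i) (k i)) \<Longrightarrow>
    diag_block_mat (map A is) \<in> carrier_mat (sum_list (map n is)) (sum_list (map k is))"
  by (induction "is") (auto simp: Let_def)

lemma map_mat_append_rows:
  assumes "A \<in> carrier_mat nr1 nc" "B \<in> carrier_mat nr2 nc"
  shows "map_mat f (A @\<^sub>r B) = map_mat f A @\<^sub>r map_mat f B"
  using assms by (intro eq_matI) (auto simp: append_rows_def)

lemma map_mat_block_col:
  "(\<And>i. i \<in> set is \<Longrightarrow> B i \<in> carrier_mat (n i) nc) \<Longrightarrow>
    map_mat f (block_col nc (map B is)) = block_col nc (map (\<lambda>i. map_mat f (B i)) is)"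
proof (induction "is")
  case (Cons i "is")
  then show ?case
    using map_mat_append_rows[of "B i" "n i" nc "block_col nc (map B is)" "sum_list (map n is)" f]
      block_col_carrier[of "is" B n nc] by simp
qed (auto intro!: eq_matI)

text \<open>Statements about block rows follow from those about block columns, since a block row is the
  transpose of a block column by definition.\<close>
lemma map_mat_block_row:
  assumes "\<And>i. i \<in> set is \<Longrightarrow> C i \<in> carrier_mat nr (n i)"
  shows "map_mat f (block_row nr (map C is)) = block_row nr (map (\<lambda>i. map_mat f (C i)) is)"
proof -
  have "map_mat f (block_row nr (map C is)) =
      transpose_mat (map_mat f (block_col nr (map (\<lambda>i. transpose_mat (C i)) is)))"
    by (simp add: block_row_def map_mat_transpose o_def)
  also have "\<dots> = block_row nr (map (\<lambda>i. map_mat f (C i)) is)"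
    using assms by (subst map_mat_block_col[of _ _ n])
      (auto simp: block_row_def map_mat_transpose o_def)
  finally show ?thesis .
qed

lemma diag_mult_diag_block_mat:
  fixes A B :: "'b \<Rightarrow> 'a::comm_ring_1 mat"
  shows "(\<And>i. i \<in> set is \<Longrightarrow> A i \<in> carrier_mat (n i) (n i)) \<Longrightarrow>
    (\<And>i. i \<in> set is \<Longrightarrow> B i \<in> carrier_mat (n i) (n i)) \<Longrightarrow>
    diag_block_mat (map A is) * diag_block_mat (map B is) = diag_block_mat (map (\<lambda>i. A i * B i) is)"
proof (induction "is")
  case (Cons i "is")
  let ?N = "sum_list (map n is)"
  have AB: "\<And>j. j \<in> set is \<Longrightarrow> A j * B j \<in> carrier_mat (n j) (n j)"
    using Cons.prems mult_carrier_mat by (metis list.set_intros(2))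
  have c: "A i \<in> carrier_mat (n i) (n i)" "B i \<in> carrier_mat (n i) (n i)"
    "diag_block_mat (map A is) \<in> carrier_mat ?N ?N" "diag_block_mat (map B is) \<in> carrier_mat ?N ?N"
    "diag_block_mat (map (\<lambda>i. A i * B i) is) \<in> carrier_mat ?N ?N"
    using Cons.prems AB by (auto intro!: diag_block_mat_carrier)
  have "diag_block_mat (map A (i # is)) * diag_block_mat (map B (i # is)) =
    four_block_mat (A i) (0\<^sub>m (n i) ?N) (0\<^sub>m ?N (n i)) (diag_block_mat (map A is)) *
    four_block_mat (B i) (0\<^sub>m (n i) ?N) (0\<^sub>m ?N (n i)) (diag_block_mat (map B is))"
    using c by (simp add: Let_def)
  also have "\<dots> = four_block_mat (A i * B i) (0\<^sub>m (n i) ?N) (0\<^sub>m ?N (n i))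
      (diag_block_mat (map A is) * diag_block_mat (map B is))"
    using c by (subst mult_four_block_mat[of _ "n i" "n i" _ ?N _ ?N _ _ "n i" _ ?N]) auto
  also have "\<dots> = diag_block_mat (map (\<lambda>i. A i * B i) (i # is))"
    using c Cons carrier_matD[OF c(1)] carrier_matD[OF c(2)] by (simp add: Let_def)
  finally show ?case .
qed auto

lemma diag_block_mat_mult_block_col:
  fixes A B :: "'b \<Rightarrow> 'a::comm_ring_1 mat"
  shows "(\<And>i. i \<in> set is \<Longrightarrow> A i \<in> carrier_mat (n i) (n i)) \<Longrightarrow>
    (\<And>i. i \<in> set is \<Longrightarrow> B i \<in> carrier_mat (n i) nc) \<Longrightarrow>
    diag_block_mat (map A is) * block_col nc (map B is) = block_col nc (map (\<lambda>i. A i * B i) is)"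
proof (induction "is")
  case (Cons i "is")
  let ?N = "sum_list (map n is)"
  have AB: "\<And>j. j \<in> set is \<Longrightarrow> A j * B j \<in> carrier_mat (n j) nc"
    using Cons.prems mult_carrier_mat by (metis list.set_intros(2))
  have c: "A i \<in> carrier_mat (n i) (n i)" "B i \<in> carrier_mat (n i) nc"
    "diag_block_mat (map A is) \<in> carrier_mat ?N ?N" "block_col nc (map B is) \<in> carrier_mat ?N nc"
    "block_col nc (map (\<lambda>i. A i * B i) is) \<in> carrier_mat ?N nc"
    using Cons.prems AB by (auto intro!: diag_block_mat_carrier block_col_carrier)
  have "diag_block_mat (map A (i # is)) * block_col nc (map B (i # is)) =
    four_block_mat (A i) (0\<^sub>m (n i) ?N) (0\<^sub>m ?N (n i)) (diag_block_mat (map A is)) *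
    four_block_mat (B i) (0\<^sub>m (n i) 0) (block_col nc (map B is)) (0\<^sub>m ?N 0)"
    using c by (simp add: Let_def append_rows_def)
  also have "\<dots> = four_block_mat (A i * B i) (0\<^sub>m (n i) 0)
      (diag_block_mat (map A is) * block_col nc (map B is)) (0\<^sub>m ?N 0)"
    using c by (subst mult_four_block_mat[of _ "n i" "n i" _ ?N _ ?N _ _ nc _ 0]) auto
  also have "\<dots> = block_col nc (map (\<lambda>i. A i * B i) (i # is))"
    using c Cons carrier_matD[OF c(1)] by (simp add: append_rows_def)
  finally show ?case .
qed auto

lemma block_col_mult:
  fixes B :: "'b \<Rightarrow> 'a::comm_ring_1 mat"
  assumes X: "X \<in> carrier_mat nc k"
  shows "(\<And>i. i \<in> set is \<Longrightarrow> B i \<in> carrier_mat (n i) nc) \<Longrightarrow>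
    block_col nc (map B is) * X = block_col k (map (\<lambda>i. B i * X) is)"
proof (induction "is")
  case (Cons i "is")
  let ?N = "sum_list (map n is)"
  have BX: "\<And>j. j \<in> set is \<Longrightarrow> B j * X \<in> carrier_mat (n j) k"
    using Cons.prems X mult_carrier_mat by (metis list.set_intros(2))
  have c: "B i \<in> carrier_mat (n i) nc" "block_col nc (map B is) \<in> carrier_mat ?N nc"
    "block_col k (map (\<lambda>i. B i * X) is) \<in> carrier_mat ?N k"
    using Cons.prems X BX by (auto intro!: block_col_carrier)
  have X0: "four_block_mat X (0\<^sub>m nc 0) (0\<^sub>m 0 k) (0\<^sub>m 0 0) = X"
    using X by (intro eq_matI) auto
  have "block_col nc (map B (i # is)) * X =
    four_block_mat (B i) (0\<^sub>m (n i) 0) (block_col nc (map B is)) (0\<^sub>m ?N 0) *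
    four_block_mat X (0\<^sub>m nc 0) (0\<^sub>m 0 k) (0\<^sub>m 0 0)"
    unfolding X0 using c by (simp add: append_rows_def)
  also have "\<dots> = four_block_mat (B i * X) (0\<^sub>m (n i) 0) (block_col nc (map B is) * X) (0\<^sub>m ?N 0)"
    using c X by (subst mult_four_block_mat[of _ "n i" nc _ 0 _ ?N _ _ k _ 0]) auto
  also have "\<dots> = block_col k (map (\<lambda>i. B i * X) (i # is))"
    using c X Cons carrier_matD[OF c(1)] by (simp add: append_rows_def)
  finally show ?case .
qed (use X in auto)

lemma mult_block_row:
  fixes C :: "'b \<Rightarrow> 'a::comm_ring_1 mat"
  assumes X: "X \<in> carrier_mat k nr" and C: "\<And>i. i \<in> set is \<Longrightarrow> C i \<in> carrier_mat nr (n i)"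
  shows "X * block_row nr (map C is) = block_row k (map (\<lambda>i. X * C i) is)"
proof -
  let ?Ct = "block_col nr (map (\<lambda>i. transpose_mat (C i)) is)"
  have Ct: "?Ct \<in> carrier_mat (sum_list (map n is)) nr"
    using C by (intro block_col_carrier) auto
  have "X * block_row nr (map C is) = transpose_mat (?Ct * transpose_mat X)"
    using X Ct by (subst transpose_mult[of _ "sum_list (map n is)" nr]) (auto simp: block_row_def o_def)
  also have "?Ct * transpose_mat X = block_col k (map (\<lambda>i. transpose_mat (C i) * transpose_mat X) is)"
    using X C by (intro block_col_mult[of _ _ _ _ _ n]) auto
  also have "map (\<lambda>i. transpose_mat (C i) * transpose_mat X) is = map transpose_mat (map (\<lambda>i. X * C i) is)"
    using X C by (auto simp: transpose_mult[OF X C])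
  finally show ?thesis by (simp add: block_row_def)
qed

text \<open>The interior unknowns act on the interface through this product. Written as a sum over the
  subdomains it can be estimated one subdomain at a time.\<close>
lemma block_row_mult_block_col:
  fixes B C :: "'b \<Rightarrow> 'a::comm_ring_1 mat"
  shows "distinct is \<Longrightarrow> (\<And>i. i \<in> set is \<Longrightarrow> C i \<in> carrier_mat nr (n i)) \<Longrightarrow>
    (\<And>i. i \<in> set is \<Longrightarrow> B i \<in> carrier_mat (n i) nc) \<Longrightarrow>
    block_row nr (map C is) * block_col nc (map B is) = mat_sum nr nc (\<lambda>i. C i * B i) (set is)"
proof (induction "is")
  case (Cons i "is")
  let ?N = "sum_list (map n is)"
  have c: "C i \<in> carrier_mat nr (n i)" "B i \<in> carrier_mat (n i) nc"
    "block_row nr (map C is) \<in> carrier_mat nr ?N" "block_col nc (map B is) \<in> carrier_mat ?N nc"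
    using Cons.prems by (auto intro!: block_row_carrier block_col_carrier)
  have "block_col nr (map (transpose_mat \<circ> C) is) \<in> carrier_mat ?N nr"
    using Cons.prems by (intro block_col_carrier) auto
  then have row: "block_row nr (map C (i # is)) =
      four_block_mat (C i) (block_row nr (map C is)) (0\<^sub>m 0 (n i)) (0\<^sub>m 0 ?N)"
    using c by (simp add: block_row_def append_rows_def transpose_four_block_mat[of _ "n i" nr _ 0 _ ?N])
  have "block_row nr (map C (i # is)) * block_col nc (map B (i # is)) =
    four_block_mat (C i) (block_row nr (map C is)) (0\<^sub>m 0 (n i)) (0\<^sub>m 0 ?N) *
    four_block_mat (B i) (0\<^sub>m (n i) 0) (block_col nc (map B is)) (0\<^sub>m ?N 0)"
    unfolding row using c by (simp add: append_rows_def)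
  also have "\<dots> = four_block_mat (C i * B i + block_row nr (map C is) * block_col nc (map B is))
      (0\<^sub>m nr 0) (0\<^sub>m 0 nc) (0\<^sub>m 0 0)"
    using c by (subst mult_four_block_mat[of _ nr "n i" _ ?N _ 0 _ _ nc _ 0]) auto
  also have "\<dots> = C i * B i + block_row nr (map C is) * block_col nc (map B is)"
    using c by (intro eq_matI) auto
  also have "\<dots> = mat_sum nr nc (\<lambda>i. C i * B i) (set (i # is))"
    using Cons mat_sum_insert[of "set is" i "\<lambda>i. C i * B i" nr nc] mult_carrier_mat[OF c(1,2)] by simp
  finally show ?case .
qed (auto simp: block_row_def mat_sum_def intro!: eq_matI)

section \<open>The iteration matrix of the splitting\<close>

text \<open>Since \<open>M\<close> is block diagonal, \<open>inv_mat M\<close> is so too and multiplies the interior rows of \<open>A\<close> by the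
  inverses of \<open>AII i\<close> and its interface rows by the inverse of \<open>MGG\<close>. The interior diagonal
  blocks become identities, which \<open>I\<close> cancels. The signs of the remaining blocks disappear under
  the absolute value.\<close>
lemma iteration_matrix_blocks:
  fixes AII AIG AGI AGG :: "nat \<Rightarrow> 'a::real_normed_field mat"
  assumes AII: "\<And>i. i \<in> {1..p} \<Longrightarrow> AII i \<in> carrier_mat (n i) (n i)"
    and invertible: "\<And>i. i \<in> {1..p} \<Longrightarrow> invertible_mat (AII i)"
    and AIG: "\<And>i. i \<in> {1..p} \<Longrightarrow> AIG i \<in> carrier_mat (n i) m"
    and AGI: "\<And>i. i \<in> {1..p} \<Longrightarrow> AGI i \<in> carrier_mat m (n i)"
    and AGG: "\<And>i. i \<in> {1..p} \<Longrightarrow> AGG i \<in> carrier_mat m m"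
    and MGG: "MGG \<in> carrier_mat m m" "invertible_mat MGG"
  defines "N \<equiv> \<Sum>i=1..p. n i"
  shows "abs_mat (1\<^sub>m (N + m) - inv_mat (splitting_mat p AII MGG) * global_mat p m AII AIG AGI AGG) =
    four_block_mat (0\<^sub>m N N)
      (block_col m (map (\<lambda>i. abs_mat (inv_mat (AII i) * AIG i)) [1..<Suc p]))
      (block_row m (map (\<lambda>i. abs_mat (inv_mat MGG * AGI i)) [1..<Suc p]))
      (abs_mat (1\<^sub>m m - inv_mat MGG * mat_sum m m AGG {1..p}))"
proof -
  let ?Mi = "inv_mat MGG"
  define ks where "ks = [1..<Suc p]"
  have set_ks: "set ks = {1..p}" by (auto simp: ks_def)
  have N: "N = sum_list (map n ks)"
    unfolding N_def set_ks[symmetric] by (rule sum.distinct_set_conv_list) (simp add: ks_def)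
  note AIIi = inv_mat_invertible[OF AII invertible] and Mi = inv_mat_invertible[OF MGG]
  have B: "inv_mat (AII i) * AIG i \<in> carrier_mat (n i) m" if "i \<in> {1..p}" for i
    using AIIi(1)[OF that that] AIG[OF that] by simp
  have C: "?Mi * AGI i \<in> carrier_mat m (n i)" if "i \<in> {1..p}" for i
    using Mi(1) AGI[OF that] by simp
  define D where "D = diag_block_mat (map AII ks)"
  define Di where "Di = diag_block_mat (map (\<lambda>i. inv_mat (AII i)) ks)"
  define Col where "Col = block_col m (map (\<lambda>i. inv_mat (AII i) * AIG i) ks)"
  define Row where "Row = block_row m (map (\<lambda>i. ?Mi * AGI i) ks)"
  define G where "G = mat_sum m m AGG {1..p}"
  have D: "D \<in> carrier_mat N N" and Di: "Di \<in> carrier_mat N N"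
    unfolding D_def Di_def N using AII AIIi(1) set_ks by (auto intro!: diag_block_mat_carrier)
  have Col: "Col \<in> carrier_mat N m" and Row: "Row \<in> carrier_mat m N" and G: "G \<in> carrier_mat m m"
    unfolding Col_def Row_def N G_def using B C set_ks
    by (auto intro!: block_col_carrier block_row_carrier)
  have AIGc: "block_col m (map AIG ks) \<in> carrier_mat N m"
    and AGIr: "block_row m (map AGI ks) \<in> carrier_mat m N"
    unfolding N using AIG AGI set_ks by (auto intro!: block_col_carrier block_row_carrier)
  have "map (\<lambda>i. inv_mat (AII i) * AII i) ks = map (\<lambda>A. 1\<^sub>m (dim_row A)) (map AII ks)"
    using AIIi(2) set_ks carrier_matD(1)[OF AII] by auto
  moreover have "Di * D = diag_block_mat (map (\<lambda>i. inv_mat (AII i) * AII i) ks)"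
    unfolding Di_def D_def using AII AIIi(1) set_ks
    by (intro diag_mult_diag_block_mat[of _ _ n]) auto
  moreover have "sum_list (map dim_row (map AII ks)) = N"
    using AII set_ks unfolding N map_map o_def by (intro arg_cong[of _ _ sum_list] map_cong) auto
  ultimately have DiD: "Di * D = 1\<^sub>m N"
    by (simp only: diag_block_one_mat)
  have DiCol: "Di * block_col m (map AIG ks) = Col"
    unfolding Di_def Col_def using AIG AIIi(1) set_ks
    by (intro diag_block_mat_mult_block_col[of _ _ n]) auto
  have MiRow: "?Mi * block_row m (map AGI ks) = Row"
    unfolding Row_def using Mi(1) AGI set_ks by (intro mult_block_row[of _ m m _ _ n]) auto
  have inv: "inv_mat (splitting_mat p AII MGG) = four_block_mat Di (0\<^sub>m N m) (0\<^sub>m m N) ?Mi"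
  proof (rule inv_mat_eqI[of _ "N + m"])
    have spl: "splitting_mat p AII MGG = four_block_mat D (0\<^sub>m N m) (0\<^sub>m m N) MGG"
      unfolding splitting_mat_def ks_def[symmetric] D_def[symmetric] Let_def using D MGG by simp
    show "splitting_mat p AII MGG \<in> carrier_mat (N + m) (N + m)"
      unfolding spl using D MGG by auto
    show "four_block_mat Di (0\<^sub>m N m) (0\<^sub>m m N) ?Mi \<in> carrier_mat (N + m) (N + m)"
      using Di Mi by auto
    show "four_block_mat Di (0\<^sub>m N m) (0\<^sub>m m N) ?Mi * splitting_mat p AII MGG = 1\<^sub>m (N + m)"
      unfolding spl using D Di MGG Mi DiD
      by (subst mult_four_block_mat[of _ N N _ m _ m _ _ N _ m]) auto
  qed
  have "inv_mat (splitting_mat p AII MGG) * global_mat p m AII AIG AGI AGG =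
      four_block_mat (1\<^sub>m N) Col Row (?Mi * G)"
    unfolding inv global_mat_def ks_def[symmetric] D_def[symmetric] G_def[symmetric]
    using Di Mi D AIGc AGIr G DiD DiCol MiRow
    by (subst mult_four_block_mat[of _ N N _ m _ m _ _ N _ m])
       (auto simp del: upt_Suc)
  also have "1\<^sub>m (N + m) - \<dots> = four_block_mat (0\<^sub>m N N) (- Col) (- Row) (1\<^sub>m m - ?Mi * G)"
    using Col Row G Mi by (intro eq_matI) auto
  finally have "abs_mat (1\<^sub>m (N + m) - inv_mat (splitting_mat p AII MGG) * global_mat p m AII AIG AGI AGG) =
      four_block_mat (0\<^sub>m N N) (abs_mat Col) (abs_mat Row) (abs_mat (1\<^sub>m m - ?Mi * G))"
    using Col Row G Mi by (auto intro!: eq_matI simp: abs_mat_def)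
  moreover have "abs_mat Col = block_col m (map (\<lambda>i. abs_mat (inv_mat (AII i) * AIG i)) ks)"
    unfolding abs_mat_def Col_def using B set_ks by (intro map_mat_block_col[of _ _ n]) auto
  moreover have "abs_mat Row = block_row m (map (\<lambda>i. abs_mat (?Mi * AGI i)) ks)"
    unfolding abs_mat_def Row_def using C set_ks by (intro map_mat_block_row[of _ _ _ n]) auto
  ultimately show ?thesis unfolding ks_def[symmetric] by (simp only: G_def)
qed

lemma abs_mat_carrier [simp]: "A \<in> carrier_mat nr nc \<Longrightarrow> abs_mat A \<in> carrier_mat nr nc"
  by (simp add: abs_mat_def)

lemma abs_mat_nonneg:
  "a < dim_row (abs_mat A) \<Longrightarrow> b < dim_col (abs_mat A) \<Longrightarrow> 0 \<le> abs_mat A $$ (a, b)"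
  by (simp add: abs_mat_def)

lemma norm_mult_mat_vec_le:
  fixes A :: "'a::real_normed_field mat"
  assumes A: "A \<in> carrier_mat nr nc" and z: "z \<in> carrier_vec nc" and y: "y \<in> carrier_vec nc"
    and le: "\<And>b. b < nc \<Longrightarrow> norm (z $ b) \<le> y $ b" and a: "a < nr"
  shows "norm ((A *\<^sub>v z) $ a) \<le> (abs_mat A *\<^sub>v y) $ a"
proof -
  have "norm ((A *\<^sub>v z) $ a) \<le> (\<Sum>b=0..<nc. norm (A $$ (a, b) * z $ b))"
    using A z a by (auto simp: scalar_prod_def norm_sum)
  also have "\<dots> \<le> (\<Sum>b=0..<nc. norm (A $$ (a, b)) * y $ b)"
    by (intro sum_mono) (auto simp: norm_mult intro!: mult_left_mono le)
  also have "\<dots> = (abs_mat A *\<^sub>v y) $ a"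
    using A y a by (simp add: abs_mat_def scalar_prod_def)
  finally show ?thesis .
qed

lemma nonneg_mat_mult_vec_mono:
  fixes A :: "real mat"
  assumes A: "A \<in> carrier_mat nr nc" and nonneg: "\<And>a b. a < nr \<Longrightarrow> b < nc \<Longrightarrow> 0 \<le> A $$ (a, b)"
    and "y \<in> carrier_vec nc" and "z \<in> carrier_vec nc" and "y \<le> z"
  shows "A *\<^sub>v y \<le> A *\<^sub>v z"
  using assms unfolding less_eq_vec_def
  by (auto simp: scalar_prod_def intro!: sum_mono mult_left_mono)

text \<open>Elimination of the interior part of the weight. Write \<open>w = (u, v)\<close>. The interior rows give
  \<open>Cl v \<le> \<gamma> u\<close>, hence \<open>R Cl v \<le> \<gamma> R u \<le> R u\<close>, and the interface rows give
  \<open>R u + H v \<le> \<gamma> v\<close>; so \<open>v\<close> alone is a weight for \<open>R Cl + H\<close>.\<close>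
lemma four_block_subinvariant:
  fixes Cl R H :: "real mat"
  assumes Cl: "Cl \<in> carrier_mat N m" and R: "R \<in> carrier_mat m N" and H: "H \<in> carrier_mat m m"
    and Rnn: "\<And>a b. a < m \<Longrightarrow> b < N \<Longrightarrow> R $$ (a, b) \<ge> 0"
    and w: "w \<in> carrier_vec (N + m)" "\<And>a. a < N + m \<Longrightarrow> w $ a > 0"
    and \<gamma>: "0 \<le> \<gamma>" "\<gamma> < 1"
    and le: "four_block_mat (0\<^sub>m N N) Cl R H *\<^sub>v w \<le> \<gamma> \<cdot>\<^sub>v w"
    and a: "a < m"
  shows "((R * Cl) *\<^sub>v vec_last w m) $ a + (H *\<^sub>v vec_last w m) $ a \<le> \<gamma> * vec_last w m $ a"
proof -
  define u v where "u = vec_first w N" and "v = vec_last w m"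
  have u: "u \<in> carrier_vec N" and v: "v \<in> carrier_vec m" and uv: "w = u @\<^sub>v v"
    using w(1) by (auto simp: u_def v_def)
  have u_pos: "u $ b > 0" if "b < N" for b
    using w(2)[of b] that by (simp add: u_def vec_first_def)
  have smult_uv: "\<gamma> \<cdot>\<^sub>v (u @\<^sub>v v) = (\<gamma> \<cdot>\<^sub>v u) @\<^sub>v (\<gamma> \<cdot>\<^sub>v v)"
    by (intro eq_vecI) auto
  have "(0\<^sub>m N N *\<^sub>v u + Cl *\<^sub>v v) @\<^sub>v (R *\<^sub>v u + H *\<^sub>v v) \<le> (\<gamma> \<cdot>\<^sub>v u) @\<^sub>v (\<gamma> \<cdot>\<^sub>v v)"
    using le four_block_mat_mult_vec[OF zero_carrier_mat Cl R H u v]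
    unfolding uv smult_uv by simp
  then have *: "0\<^sub>m N N *\<^sub>v u + Cl *\<^sub>v v \<le> \<gamma> \<cdot>\<^sub>v u" "R *\<^sub>v u + H *\<^sub>v v \<le> \<gamma> \<cdot>\<^sub>v v"
    using u v Cl append_vec_le[of "0\<^sub>m N N *\<^sub>v u + Cl *\<^sub>v v" N "\<gamma> \<cdot>\<^sub>v u"
        "R *\<^sub>v u + H *\<^sub>v v" "\<gamma> \<cdot>\<^sub>v v"] by (metis add_carrier_vec mult_mat_vec_carrier
        smult_carrier_vec zero_carrier_mat)+
  have "0\<^sub>m N N *\<^sub>v u + Cl *\<^sub>v v = Cl *\<^sub>v v"
    using u v Cl by (intro eq_vecI) auto
  then have "R *\<^sub>v (Cl *\<^sub>v v) \<le> R *\<^sub>v (\<gamma> \<cdot>\<^sub>v u)"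
    using * u v Cl by (intro nonneg_mat_mult_vec_mono[OF R Rnn]) auto
  then have "((R * Cl) *\<^sub>v v) $ a \<le> \<gamma> * (R *\<^sub>v u) $ a"
    using R Cl u v a by (simp add: less_eq_vec_def mult_mat_vec[OF R])
  moreover have "(R *\<^sub>v u) $ a \<ge> 0"
    using R u a Rnn u_pos by (auto simp: scalar_prod_def less_imp_le intro!: sum_nonneg)
  then have "\<gamma> * (R *\<^sub>v u) $ a \<le> (R *\<^sub>v u) $ a"
    using \<gamma> by (simp add: mult_left_le_one_le)
  moreover have "(R *\<^sub>v u) $ a + (H *\<^sub>v v) $ a \<le> \<gamma> * v $ a"
    using *(2) H v a R u by (auto simp: less_eq_vec_def)
  ultimately show ?thesis by (simp add: v_def)
qed

section \<open>Convergence from a contraction in a weighted maximum norm\<close>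

text \<open>A local update is affine, with the linear part displayed here; differences of updates therefore
  do not depend on the right-hand side.\<close>
lemma local_update_diff:
  assumes IG: "IG j \<in> carrier_mat m m" and S: "S j \<in> carrier_mat m m" and d: "d j \<in> carrier_vec m"
    and Mi: "inv_mat MGG \<in> carrier_mat m m" and y: "y \<in> carrier_vec m" and z: "z \<in> carrier_vec m"
    and a: "a < m"
  shows "local_update MGG IG S d j y $ a - local_update MGG IG S d j z $ a =
    ((IG j - inv_mat MGG * S j) *\<^sub>v (y - z)) $ a"
proof -
  have Sv: "S j *\<^sub>v x \<in> carrier_vec m" "IG j *\<^sub>v x \<in> carrier_vec m"
      "inv_mat MGG *\<^sub>v (S j *\<^sub>v x) \<in> carrier_vec m" if "x \<in> carrier_vec m" for x
    using S IG Mi that by auto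
  have upd: "local_update MGG IG S d j x =
      IG j *\<^sub>v x + (inv_mat MGG *\<^sub>v d j - inv_mat MGG *\<^sub>v (S j *\<^sub>v x))" if "x \<in> carrier_vec m" for x
    unfolding local_update_def mult_minus_distrib_mat_vec[OF Mi d Sv(1)[OF that]] ..
  have "((IG j - inv_mat MGG * S j) *\<^sub>v (y - z)) =
      IG j *\<^sub>v (y - z) - inv_mat MGG *\<^sub>v (S j *\<^sub>v (y - z))"
    using IG S Mi y z by (simp add: minus_mult_distrib_mat_vec[OF IG, of "inv_mat MGG * S j"] assoc_mult_mat_vec[OF Mi S])
  also have "\<dots> = (IG j *\<^sub>v y - IG j *\<^sub>v z) -
      (inv_mat MGG *\<^sub>v (S j *\<^sub>v y) - inv_mat MGG *\<^sub>v (S j *\<^sub>v z))"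
    by (simp only: mult_minus_distrib_mat_vec[OF IG y z] mult_minus_distrib_mat_vec[OF S y z]
        mult_minus_distrib_mat_vec[OF Mi Sv(1)[OF y] Sv(1)[OF z]])
  finally show ?thesis
    using Sv[OF y] Sv[OF z] a Mi IG by (simp add: upd[OF y] upd[OF z] del: index_mult_mat_vec)
qed

lemma local_update_carrier:
  assumes "IG j \<in> carrier_mat m m" "S j \<in> carrier_mat m m" "d j \<in> carrier_vec m"
    "inv_mat MGG \<in> carrier_mat m m" "y \<in> carrier_vec m"
  shows "local_update MGG IG S d j y \<in> carrier_vec m"
  using assms by (auto simp: local_update_def)

text \<open>The \<open>IG j\<close> sum to the identity, and the local residuals of a solution sum to zero although the
  single ones need not vanish. Hence a solution of the interface problem is a fixed point of the summed
  update, although in general not of a single one.\<close>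
lemma sum_local_update_solution:
  fixes MGG :: "'a::field mat"
  assumes J: "finite J"
    and IG: "\<And>j. j \<in> J \<Longrightarrow> IG j \<in> carrier_mat m m" and sum_IG: "mat_sum m m IG J = 1\<^sub>m m"
    and S: "\<And>j. j \<in> J \<Longrightarrow> S j \<in> carrier_mat m m" and d: "\<And>j. j \<in> J \<Longrightarrow> d j \<in> carrier_vec m"
    and Mi: "inv_mat MGG \<in> carrier_mat m m" and y: "y \<in> carrier_vec m"
    and sol: "mat_sum m m S J *\<^sub>v y = finsum_vec TYPE('a) m d J" and a: "a < m"
  shows "(\<Sum>j\<in>J. local_update MGG IG S d j y $ a) = y $ a"
proof -
  have zero: "(\<Sum>j\<in>J. (d j - S j *\<^sub>v y) $ b) = 0" if b: "b < m" for b
  proof -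
    have "(\<Sum>j\<in>J. (d j - S j *\<^sub>v y) $ b) = (\<Sum>j\<in>J. d j $ b) - (\<Sum>j\<in>J. (S j *\<^sub>v y) $ b)"
      unfolding sum_subtractf[symmetric]
      using S b by (intro sum.cong refl) (auto dest!: S simp del: index_mult_mat_vec)
    also have "\<dots> = finsum_vec TYPE('a) m d J $ b - (mat_sum m m S J *\<^sub>v y) $ b"
      using index_finsum_vec[OF J b, of d] d mat_sum_mult_vec_index[of J S m m y b] S y b by auto
    finally show ?thesis using sol by simp
  qed
  have mv: "(inv_mat MGG *\<^sub>v x) $ a = (\<Sum>b=0..<m. inv_mat MGG $$ (a, b) * x $ b)"
    if "x \<in> carrier_vec m" for x
    using Mi a that by (auto simp: scalar_prod_def)
  have "(\<Sum>j\<in>J. (inv_mat MGG *\<^sub>v (d j - S j *\<^sub>v y)) $ a) =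
      (\<Sum>j\<in>J. \<Sum>b=0..<m. inv_mat MGG $$ (a, b) * (d j - S j *\<^sub>v y) $ b)"
    using d mult_mat_vec_carrier[OF S y] by (intro sum.cong refl mv) (simp add: minus_carrier_vec)
  also have "\<dots> = (\<Sum>b=0..<m. inv_mat MGG $$ (a, b) * (\<Sum>j\<in>J. (d j - S j *\<^sub>v y) $ b))"
    unfolding sum_distrib_left by (rule sum.swap)
  also have "\<dots> = 0" using zero by (intro sum.neutral) auto
  finally have "(\<Sum>j\<in>J. (inv_mat MGG *\<^sub>v (d j - S j *\<^sub>v y)) $ a) = 0" .
  moreover have "(\<Sum>j\<in>J. local_update MGG IG S d j y $ a) =
      (\<Sum>j\<in>J. (IG j *\<^sub>v y) $ a) + (\<Sum>j\<in>J. (inv_mat MGG *\<^sub>v (d j - S j *\<^sub>v y)) $ a)"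
    unfolding sum.distrib[symmetric] local_update_def
    using Mi IG a by (intro sum.cong refl index_add_vec) auto
  moreover have "(\<Sum>j\<in>J. (IG j *\<^sub>v y) $ a) = y $ a"
    using mat_sum_mult_vec_index[of J IG m m y a] IG y a sum_IG by simp
  ultimately show ?thesis by simp
qed

lemma injective_imp_solvable:
  fixes A :: "'a::field mat"
  assumes A: "A \<in> carrier_mat m m" and d: "d \<in> carrier_vec m"
    and inj: "\<And>z. z \<in> carrier_vec m \<Longrightarrow> A *\<^sub>v z = 0\<^sub>v m \<Longrightarrow> z = 0\<^sub>v m"
  obtains x where "x \<in> carrier_vec m" "A *\<^sub>v x = d"
proof -
  have "det A \<noteq> 0"
    using det_0_iff_vec_prod_zero_field[OF A] inj by auto
  from det_non_zero_imp_unit[OF A this, of "()"]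
  obtain B where B: "B \<in> carrier_mat m m" "A * B = 1\<^sub>m m"
    by (auto simp: Units_def ring_mat_def)
  have "A *\<^sub>v (B *\<^sub>v d) = d"
    unfolding assoc_mult_mat_vec[OF A B(1) d, symmetric] B(2) using d by simp
  then show ?thesis using B d by (intro that[of "B *\<^sub>v d"]) auto
qed

text \<open>The hypothesis \<open>contr\<close> says that the summed update is a contraction with factor \<open>\<gamma>\<close> in the maximum
  norm weighted by \<open>v\<close>, even when each subdomain is fed a different vector. It serves twice. Applied
  to one vector it shows that \<open>S\<close> has trivial kernel, so that the interface problem has exactly one
  solution. Applied to the vectors of the method it maps the weighted ball of radius
  \<open>\<gamma>^n c\<close> around that solution into the one of radius \<open>\<gamma>^(n+1) c\<close>; these balls
  are the nested sets of the asynchronous convergence argument.\<close>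
lemma async_schur_convergentI:
  fixes MGG :: "'a::real_normed_field mat" and v :: "real vec"
  assumes Mi: "inv_mat MGG \<in> carrier_mat m m"
    and IG: "\<And>j. j \<in> {1..p} \<Longrightarrow> IG j \<in> carrier_mat m m" and sum_IG: "mat_sum m m IG {1..p} = 1\<^sub>m m"
    and S: "\<And>j. j \<in> {1..p} \<Longrightarrow> S j \<in> carrier_mat m m" and d: "\<And>j. j \<in> {1..p} \<Longrightarrow> d j \<in> carrier_vec m"
    and v: "\<And>a. a < m \<Longrightarrow> v $ a > 0" and \<gamma>: "0 \<le> \<gamma>" "\<gamma> < 1"
    and contr: "\<And>c z a. 0 \<le> c \<Longrightarrow> (\<And>j. j \<in> {1..p} \<Longrightarrow> z j \<in> carrier_vec m) \<Longrightarrow>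
      (\<And>j b. j \<in> {1..p} \<Longrightarrow> b < m \<Longrightarrow> norm (z j $ b) \<le> c * v $ b) \<Longrightarrow> a < m \<Longrightarrow>
      norm (\<Sum>j\<in>{1..p}. ((IG j - inv_mat MGG * S j) *\<^sub>v z j) $ a) \<le> \<gamma> * c * v $ a"
  shows "async_schur_convergent p m MGG IG S d"
proof -
  let ?J = "{1..p}" and ?T = "\<lambda>d j. local_update MGG IG S d j" and ?S = "mat_sum m m S {1..p}"
  have T_contr: "norm ((\<Sum>j\<in>?J. ?T e j (y j) $ a) - (\<Sum>j\<in>?J. ?T e j (z j) $ a)) \<le> \<gamma> * c * v $ a"
    if "0 \<le> c" "\<And>j. j \<in> ?J \<Longrightarrow> e j \<in> carrier_vec m"
      "\<And>j. j \<in> ?J \<Longrightarrow> y j \<in> carrier_vec m" "\<And>j. j \<in> ?J \<Longrightarrow> z j \<in> carrier_vec m"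
      "\<And>j b. j \<in> ?J \<Longrightarrow> b < m \<Longrightarrow> norm (y j $ b - z j $ b) \<le> c * v $ b" "a < m" for c e y z a
  proof -
    have "(\<Sum>j\<in>?J. ?T e j (y j) $ a) - (\<Sum>j\<in>?J. ?T e j (z j) $ a) =
        (\<Sum>j\<in>?J. ((IG j - inv_mat MGG * S j) *\<^sub>v (y j - z j)) $ a)"
      unfolding sum_subtractf[symmetric]
      using local_update_diff[OF IG S that(2) Mi that(3,4,6)] by (intro sum.cong) auto
    moreover have "norm ((y j - z j) $ b) \<le> c * v $ b" if "j \<in> ?J" "b < m" for j b
      using \<open>\<And>j b. j \<in> ?J \<Longrightarrow> b < m \<Longrightarrow> norm (y j $ b - z j $ b) \<le> c * v $ b\<close>[OF that]
        \<open>\<And>j. j \<in> ?J \<Longrightarrow> z j \<in> carrier_vec m\<close>[OF that(1)] that(2) by simp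
    ultimately show ?thesis using contr[of c "\<lambda>j. y j - z j" a] that by simp
  qed
  have bound_exists: "\<exists>c\<ge>0. \<forall>j\<in>?J. \<forall>b<m. norm (y j $ b) \<le> c * v $ b" for y :: "nat \<Rightarrow> 'a vec"
  proof (intro exI[of _ "\<Sum>(j, b)\<in>?J \<times> {..<m}. norm (y j $ b) / v $ b"] conjI ballI allI impI)
    show "0 \<le> (\<Sum>(j, b)\<in>?J \<times> {..<m}. norm (y j $ b) / v $ b)"
      using v by (intro sum_nonneg) (auto intro!: divide_nonneg_pos)
    fix j b assume jb: "j \<in> ?J" "b < m"
    then have "norm (y j $ b) / v $ b \<le> (\<Sum>(j, b)\<in>?J \<times> {..<m}. norm (y j $ b) / v $ b)"
      using v member_le_sum[of "(j, b)" "?J \<times> {..<m}" "\<lambda>(j, b). norm (y j $ b) / v $ b"]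
      by (auto simp: divide_nonneg_pos)
    then show "norm (y j $ b) \<le> (\<Sum>(j, b)\<in>?J \<times> {..<m}. norm (y j $ b) / v $ b) * v $ b"
      using v[OF jb(2)] by (simp add: field_simps)
  qed
  have to_0: "(\<lambda>n. \<gamma> ^ n * c * v $ a) \<longlonglongrightarrow> 0" for c a
    using \<gamma> by (intro tendsto_mult_left_zero LIMSEQ_realpow_zero) auto
  \<comment> \<open>A kernel vector and zero are both fixed points for the right-hand side zero.\<close>
  have kernel: "z = 0\<^sub>v m" if z: "z \<in> carrier_vec m" and Sz: "?S *\<^sub>v z = 0\<^sub>v m" for z
  proof -
    let ?e = "\<lambda>_::nat. 0\<^sub>v m :: 'a vec"
    have e: "finsum_vec TYPE('a) m ?e ?J = 0\<^sub>v m"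
      using finsum_vec_closed[of ?e ?J m] index_finsum_vec[of ?J _ m ?e]
      by (intro eq_vecI) auto
    have S0: "?S *\<^sub>v 0\<^sub>v m = 0\<^sub>v m" by (intro eq_vecI) (auto simp: mat_sum_def)
    have fix_z: "(\<Sum>j\<in>?J. ?T ?e j z $ a) = z $ a" and fix_0: "(\<Sum>j\<in>?J. ?T ?e j (0\<^sub>v m) $ a) = 0"
      if "a < m" for a
      using sum_local_update_solution[of ?J IG m S ?e MGG _ a] IG sum_IG S Mi z Sz S0 e that by auto
    have step: "norm (z $ a) \<le> \<gamma> * c * v $ a"
      if "0 \<le> c" "\<And>b. b < m \<Longrightarrow> norm (z $ b) \<le> c * v $ b" "a < m" for c a
      using T_contr[of c ?e "\<lambda>_. z" "\<lambda>_. 0\<^sub>v m" a] fix_z[OF that(3)] fix_0[OF that(3)] z that by simp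
    obtain c where c: "c \<ge> 0" "\<And>b. 1 \<le> p \<Longrightarrow> b < m \<Longrightarrow> norm (z $ b) \<le> c * v $ b"
      using bound_exists[of "\<lambda>_. z"] by auto
    \<comment> \<open>Without subdomains the identity on the interface is an empty sum, so the interface is empty.\<close>
    have p: "1 \<le> p" if "m > 0"
    proof (rule ccontr)
      assume "\<not> 1 \<le> p"
      then have "mat_sum m m IG {1..p} $$ (0, 0) = 0" using that by (simp add: mat_sum_def)
      then show False using sum_IG that by simp
    qed
    have geo: "norm (z $ b) \<le> \<gamma> ^ n * c * v $ b" if "b < m" for n b
      using that
    proof (induction n arbitrary: b)
      case 0
      then show ?case using c(2) p by simp
    next
      case (Suc n)
      then show ?case using step[of "\<gamma> ^ n * c" b] \<gamma> c(1) by (simp add: mult.assoc)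
    qed
    have "norm (z $ b) \<le> 0" if "b < m" for b
      by (rule LIMSEQ_le_const[OF to_0[of c b]]) (use geo[OF that] in blast)
    then show ?thesis using z by (intro eq_vecI) auto
  qed
  have dsum: "finsum_vec TYPE('a) m d ?J \<in> carrier_vec m"
    using d by (intro finsum_vec_closed) auto
  obtain xs where xs: "xs \<in> carrier_vec m" "?S *\<^sub>v xs = finsum_vec TYPE('a) m d ?J"
    using injective_imp_solvable[OF mat_sum_carrier dsum kernel] by blast
  have unique: "z = xs" if z: "z \<in> carrier_vec m" "?S *\<^sub>v z = finsum_vec TYPE('a) m d ?J" for z
  proof -
    have "?S *\<^sub>v (z - xs) = 0\<^sub>v m"
      using mult_minus_distrib_mat_vec[of ?S m m z xs] z(1) xs(1) z(2) xs(2) dsum by simp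
    then have "z - xs = 0\<^sub>v m" using kernel[of "z - xs"] z xs by simp
    then have "(z - xs) $ a = 0" if "a < m" for a using that by simp
    then show ?thesis using z(1) xs(1) by (intro eq_vecI) auto
  qed
  have conv: "vec_tendsto m (x i) xs"
    if x0: "\<forall>i\<in>?J. x0 i \<in> carrier_vec m" and P: "admissible_updates p P" and \<tau>: "admissible_delays p \<tau>"
      and x: "async_iterates p m MGG IG S d x0 P \<tau> x" and i: "i \<in> ?J" for x0 P \<tau> x i
  proof -
    obtain c where c: "c \<ge> 0" "\<And>j b. j \<in> ?J \<Longrightarrow> b < m \<Longrightarrow> norm ((x0 j - xs) $ b) \<le> c * v $ b"
      using bound_exists[of "\<lambda>j. x0 j - xs"] by blast
    define X where "X n = {y \<in> carrier_vec m. \<forall>b<m. norm (y $ b - xs $ b) \<le> \<gamma> ^ n * c * v $ b}" for n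
    define F where "F (i::nat) y = finsum_vec TYPE('a) m (\<lambda>j. ?T d j (y j)) ?J" for i and y :: "nat \<Rightarrow> 'a vec"
    have X: "\<exists>K. \<forall>k\<ge>K. \<forall>i\<in>?J. x i k \<in> X n" for n
    proof (rule nested_sets_asynchronous_convergence[where F = F and P = P and \<tau> = \<tau>])
      fix n
      have "\<gamma> ^ Suc n * c * v $ b \<le> \<gamma> ^ n * c * v $ b" if "b < m" for b
        using \<gamma> c(1) v[OF that] by (intro mult_right_mono power_decreasing) auto
      then show "X (Suc n) \<subseteq> X n" unfolding X_def using order_trans by blast
    next
      fix n i and y :: "nat \<Rightarrow> 'a vec" assume "i \<in> ?J" and y: "\<And>j. j \<in> ?J \<Longrightarrow> y j \<in> X n"
      have yc: "\<And>j. j \<in> ?J \<Longrightarrow> y j \<in> carrier_vec m" using y by (simp add: X_def)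
      then have Tc: "(\<lambda>j. ?T d j (y j)) \<in> ?J \<rightarrow> carrier_vec m"
        using local_update_carrier[of IG _ m S d MGG] IG S d Mi by blast
      have "norm (F i y $ a - xs $ a) \<le> \<gamma> ^ Suc n * c * v $ a" if a: "a < m" for a
      proof -
        have "norm ((\<Sum>j\<in>?J. ?T d j (y j) $ a) - (\<Sum>j\<in>?J. ?T d j xs $ a)) \<le> \<gamma> * (\<gamma> ^ n * c) * v $ a"
          using y yc d xs a \<gamma> c(1) by (intro T_contr) (auto simp: X_def)
        moreover have "(\<Sum>j\<in>?J. ?T d j xs $ a) = xs $ a"
          by (rule sum_local_update_solution[where m = m]) (use IG sum_IG S d Mi xs a in auto)
        moreover have "F i y $ a = (\<Sum>j\<in>?J. ?T d j (y j) $ a)"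
          unfolding F_def by (rule index_finsum_vec[OF finite_atLeastAtMost a Tc])
        ultimately show ?thesis by (simp only: power_Suc mult.assoc)
      qed
      then show "F i y \<in> X (Suc n)"
        using finsum_vec_closed[OF Tc] by (simp add: X_def F_def)
    next
      fix i assume "i \<in> ?J"
      then show "x i 0 \<in> X 0"
        using x x0 c(2) xs by (auto simp: X_def async_iterates_def)
    qed (use x P \<tau> in \<open>auto simp: F_def async_iterates_def admissible_updates_def admissible_delays_def\<close>)
    show ?thesis
      unfolding vec_tendsto_def
    proof (intro allI impI)
      fix a assume a: "a < m"
      show "(\<lambda>k. x i k $ a) \<longlonglongrightarrow> xs $ a"
        unfolding tendsto_iff dist_norm
      proof (intro allI impI)
        fix e :: real assume "0 < e"
        then obtain n where n: "\<gamma> ^ n * c * v $ a < e"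
          using order_tendstoD(2)[OF to_0[of c a]] by (auto simp: eventually_sequentially)
        from X[of n] show "eventually (\<lambda>k. norm (x i k $ a - xs $ a) < e) sequentially"
          unfolding eventually_sequentially X_def using n a i by fastforce
      qed
    qed
  qed
  show ?thesis
    unfolding async_schur_convergent_def using xs unique conv by blast
qed

section \<open>Convergence of the asynchronous Schur method\<close>

text \<open>The eliminated term of the Schur complement is kept as a product of two factors, because only the
  absolute values of these factors occur in the absolute value of the iteration matrix.\<close>
lemma schur_iteration_split:
  fixes AII AIG AGI AGG IG MGG :: "'a::field mat"
  assumes Ai: "inv_mat AII \<in> carrier_mat n n" and AIG: "AIG \<in> carrier_mat n m" and AGI: "AGI \<in> carrier_mat m n"
    and AGG: "AGG \<in> carrier_mat m m" and Mi: "inv_mat MGG \<in> carrier_mat m m" and IG: "IG \<in> carrier_mat m m"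
    and z: "z \<in> carrier_vec m"
  shows "(IG - inv_mat MGG * schur_mat AII AIG AGI AGG) *\<^sub>v z =
    (IG - inv_mat MGG * AGG) *\<^sub>v z + (inv_mat MGG * AGI) *\<^sub>v ((inv_mat AII * AIG) *\<^sub>v z)"
proof -
  let ?Q = "AGI * inv_mat AII * AIG"
  have Q: "?Q \<in> carrier_mat m m" using Ai AIG AGI by simp
  have MQ: "inv_mat MGG * ?Q = inv_mat MGG * AGI * (inv_mat AII * AIG)"
    using assoc_mult_mat[OF Mi AGI, of "inv_mat AII * AIG" m] assoc_mult_mat[OF AGI Ai AIG] Ai AIG
    by simp
  have MQc: "inv_mat MGG * ?Q \<in> carrier_mat m m" and MA: "inv_mat MGG * AGG \<in> carrier_mat m m"
    using Mi Q AGG by auto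
  have "IG - inv_mat MGG * schur_mat AII AIG AGI AGG = (IG - inv_mat MGG * AGG) + inv_mat MGG * ?Q"
    unfolding schur_mat_def mult_minus_distrib_mat[OF Mi AGG Q]
    using IG MQc MA Mi AGG AIG AGI by (intro eq_matI) auto
  also have "\<dots> *\<^sub>v z = (IG - inv_mat MGG * AGG) *\<^sub>v z + inv_mat MGG * ?Q *\<^sub>v z"
    using minus_carrier_mat[OF MA] MQc z by (intro add_mult_distrib_mat_vec) auto
  also have "inv_mat MGG * ?Q *\<^sub>v z = (inv_mat MGG * AGI) *\<^sub>v ((inv_mat AII * AIG) *\<^sub>v z)"
    unfolding MQ using Mi AGI Ai AIG z by (intro assoc_mult_mat_vec) auto
  finally show ?thesis .
qed

theorem theorem17:
  fixes p m :: nat and n :: "nat \<Rightarrow> nat"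
    and AII AIG AGI AGG IG :: "nat \<Rightarrow> 'a::real_normed_field mat"
    and MGG :: "'a mat"
    and bI bG :: "nat \<Rightarrow> 'a vec"
  assumes "\<And>i. i \<in> {1..p} \<Longrightarrow> AII i \<in> carrier_mat (n i) (n i)"
    and "\<And>i. i \<in> {1..p} \<Longrightarrow> invertible_mat (AII i)"
    and "\<And>i. i \<in> {1..p} \<Longrightarrow> AIG i \<in> carrier_mat (n i) m"
    and "\<And>i. i \<in> {1..p} \<Longrightarrow> AGI i \<in> carrier_mat m (n i)"
    and "\<And>i. i \<in> {1..p} \<Longrightarrow> AGG i \<in> carrier_mat m m"
    and "\<And>i. i \<in> {1..p} \<Longrightarrow> bI i \<in> carrier_vec (n i)"
    and "\<And>i. i \<in> {1..p} \<Longrightarrow> bG i \<in> carrier_vec m"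
    and "MGG \<in> carrier_mat m m"
    and "invertible_mat MGG"
    and "\<And>i. i \<in> {1..p} \<Longrightarrow> IG i \<in> carrier_mat m m"
    and "mat_sum m m IG {1..p} = 1\<^sub>m m"
    and "mat_sum m m (\<lambda>i. abs_mat (IG i - inv_mat MGG * AGG i)) {1..p}
         = abs_mat (mat_sum m m (\<lambda>i. IG i - inv_mat MGG * AGG i) {1..p})"
    and "spectral_radius (map_mat complex_of_real (abs_mat
           (1\<^sub>m ((\<Sum>i=1..p. n i) + m)
            - inv_mat (splitting_mat p AII MGG) * global_mat p m AII AIG AGI AGG))) < 1"
  shows "async_schur_convergent p m MGG IG
           (\<lambda>i. schur_mat (AII i) (AIG i) (AGI i) (AGG i))
           (\<lambda>i. schur_rhs (AII i) (AGI i) (bI i) (bG i))"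
proof -
  note AII = assms(1) and AII_inv = assms(2) and AIG = assms(3) and AGI = assms(4) and AGG = assms(5)
    and bI = assms(6) and bG = assms(7) and MGG = assms(8,9) and IG = assms(10)
    and sum_IG = assms(11) and no_cancel = assms(12) and radius = assms(13)
  let ?J = "{1..p}" and ?Mi = "inv_mat MGG"
  define N where "N = (\<Sum>i=1..p. n i)"
  define ks where "ks = [1..<Suc p]"
  have ks: "set ks = ?J" "distinct ks" "N = sum_list (map n ks)"
    by (auto simp: ks_def N_def sum_set_upt_conv_sum_list_nat[symmetric] atLeastLessThanSuc_atLeastAtMost simp del: upt_Suc)
  define B where "B i = inv_mat (AII i) * AIG i" for i
  define C where "C i = ?Mi * AGI i" for i
  define F where "F i = IG i - ?Mi * AGG i" for i
  note Ai = inv_mat_invertible(1)[OF AII AII_inv] and Mi = inv_mat_invertible(1)[OF MGG]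
  have B: "B i \<in> carrier_mat (n i) m" if "i \<in> ?J" for i
    unfolding B_def using Ai[OF that that] AIG[OF that] by simp
  have C: "C i \<in> carrier_mat m (n i)" and F: "F i \<in> carrier_mat m m" if "i \<in> ?J" for i
    unfolding C_def F_def using mult_carrier_mat[OF Mi AGI[OF that]] minus_carrier_mat[OF mult_carrier_mat[OF Mi AGG[OF that]]]
    by simp_all
  define Col where "Col = block_col m (map (\<lambda>i. abs_mat (B i)) ks)"
  define Row where "Row = block_row m (map (\<lambda>i. abs_mat (C i)) ks)"
  define H where "H = mat_sum m m (\<lambda>i. abs_mat (F i)) ?J"
  have Col: "Col \<in> carrier_mat N m" and Row: "Row \<in> carrier_mat m N" and H: "H \<in> carrier_mat m m"
    unfolding Col_def Row_def H_def ks(3) using B C ks(1)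
    by (auto intro!: block_col_carrier block_row_carrier)
  \<comment> \<open>The assumption on absolute values turns the interface block of the iteration matrix, the absolute value
  of a sum, into the sum of the local absolute values.\<close>
  have "mat_sum m m F ?J = 1\<^sub>m m - ?Mi * mat_sum m m AGG ?J"
    unfolding F_def using Mi AGG IG sum_IG mult_mat_sum[of ?Mi m m ?J AGG m]
    by (subst mat_sum_diff) auto
  then have H_eq: "abs_mat (1\<^sub>m m - ?Mi * mat_sum m m AGG ?J) = H"
    using no_cancel[folded F_def] by (simp add: H_def)
  define T where "T = four_block_mat (0\<^sub>m N N) Col Row H"
  have T_eq: "abs_mat (1\<^sub>m (N + m) - inv_mat (splitting_mat p AII MGG) * global_mat p m AII AIG AGI AGG) = T"
    unfolding T_def Col_def Row_def ks_def B_def C_def H_eq[symmetric] N_def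
    using AII AII_inv AIG AGI AGG MGG by (rule iteration_matrix_blocks)
  have T: "T \<in> carrier_mat (N + m) (N + m)"
    unfolding T_def using Col Row H by auto
  have T_nonneg: "T $$ (a, b) \<ge> 0" if "a < N + m" "b < N + m" for a b
    using carrier_matD[OF T] that unfolding T_eq[symmetric] by (intro abs_mat_nonneg) simp_all
  obtain w \<gamma> where w: "w \<in> carrier_vec (N + m)" "\<And>a. a < N + m \<Longrightarrow> w $ a > 0"
    and \<gamma>: "0 \<le> \<gamma>" "\<gamma> < 1" and Tw: "T *\<^sub>v w \<le> \<gamma> \<cdot>\<^sub>v w"
    using subinvariant_weight[OF T T_nonneg] radius T_eq unfolding N_def by metis
  define v where "v = vec_last w m"
  have v: "v \<in> carrier_vec m" "\<And>a. a < m \<Longrightarrow> v $ a > 0"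
    using w by (auto simp: v_def vec_last_def)
  have Row_nonneg: "Row $$ (a, b) \<ge> 0" if "a < m" "b < N" for a b
    using T_nonneg[of "N + a" b] that Col Row H by (simp add: T_def)
  have RC: "Row * Col = mat_sum m m (\<lambda>i. abs_mat (C i) * abs_mat (B i)) ?J"
    unfolding Row_def Col_def ks(1)[symmetric]
    using B C ks by (intro block_row_mult_block_col[of _ _ _ n]) auto
  have weight: "(\<Sum>i\<in>?J. (abs_mat (C i) *\<^sub>v (abs_mat (B i) *\<^sub>v v)) $ a + (abs_mat (F i) *\<^sub>v v) $ a) \<le> \<gamma> * v $ a"
    if a: "a < m" for a
  proof -
    have CB: "abs_mat (C i) * abs_mat (B i) \<in> carrier_mat m m" if "i \<in> ?J" for i
      using abs_mat_carrier[OF B[OF that]] abs_mat_carrier[OF C[OF that]] by simp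
    have "((Row * Col) *\<^sub>v v) $ a = (\<Sum>i\<in>?J. (abs_mat (C i) *\<^sub>v (abs_mat (B i) *\<^sub>v v)) $ a)"
      unfolding RC
      using mat_sum_mult_vec_index[of ?J "\<lambda>i. abs_mat (C i) * abs_mat (B i)" m m v a] CB v(1) a
        assoc_mult_mat_vec[OF abs_mat_carrier[OF C] abs_mat_carrier[OF B] v(1)] by simp
    moreover have "(H *\<^sub>v v) $ a = (\<Sum>i\<in>?J. (abs_mat (F i) *\<^sub>v v) $ a)"
      unfolding H_def using mat_sum_mult_vec_index[of ?J "\<lambda>i. abs_mat (F i)" m m v a] F v(1) a by simp
    moreover have "((Row * Col) *\<^sub>v v) $ a + (H *\<^sub>v v) $ a \<le> \<gamma> * v $ a"
      unfolding v_def
      by (rule four_block_subinvariant[OF Col Row H Row_nonneg w \<gamma> Tw[unfolded T_def] a])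
    ultimately show ?thesis by (simp add: sum.distrib)
  qed
  show ?thesis
  proof (rule async_schur_convergentI[OF Mi IG sum_IG _ _ v(2) \<gamma>])
    fix j assume j: "j \<in> ?J"
    show "schur_mat (AII j) (AIG j) (AGI j) (AGG j) \<in> carrier_mat m m"
      unfolding schur_mat_def using Ai[OF j j] AIG[OF j] AGI[OF j] by (intro minus_carrier_mat) auto
    show "schur_rhs (AII j) (AGI j) (bI j) (bG j) \<in> carrier_vec m"
      using Ai[OF j j] AGI[OF j] bI[OF j] bG[OF j] by (auto simp: schur_rhs_def)
  next
    fix c :: real and z :: "nat \<Rightarrow> 'a vec" and a
    assume c: "0 \<le> c" and z: "\<And>j. j \<in> ?J \<Longrightarrow> z j \<in> carrier_vec m"
      and zv: "\<And>j b. j \<in> ?J \<Longrightarrow> b < m \<Longrightarrow> norm (z j $ b) \<le> c * v $ b" and a: "a < m"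
    have "norm (((IG j - ?Mi * schur_mat (AII j) (AIG j) (AGI j) (AGG j)) *\<^sub>v z j) $ a) \<le>
        c * ((abs_mat (C j) *\<^sub>v (abs_mat (B j) *\<^sub>v v)) $ a + (abs_mat (F j) *\<^sub>v v) $ a)"
      if j: "j \<in> ?J" for j
    proof -
      note Bj = B[OF j] and Cj = C[OF j] and Fj = F[OF j] and zj = z[OF j]
      note aB = abs_mat_carrier[OF Bj] and aC = abs_mat_carrier[OF Cj] and aF = abs_mat_carrier[OF Fj]
      have cv: "c \<cdot>\<^sub>v v \<in> carrier_vec m" using v(1) by simp
      have Fz: "norm ((F j *\<^sub>v z j) $ a) \<le> c * (abs_mat (F j) *\<^sub>v v) $ a"
        using norm_mult_mat_vec_le[OF Fj zj cv _ a] zv[OF j] v(1) a aF by (simp add: mult_mat_vec[OF aF v(1)])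
      have Bz: "norm ((B j *\<^sub>v z j) $ b) \<le> (c \<cdot>\<^sub>v (abs_mat (B j) *\<^sub>v v)) $ b" if "b < n j" for b
        using norm_mult_mat_vec_le[OF Bj zj cv _ that] zv[OF j] v(1) by (simp add: mult_mat_vec[OF aB v(1)])
      have Bv: "abs_mat (B j) *\<^sub>v v \<in> carrier_vec (n j)" using aB v(1) by simp
      have "norm ((C j *\<^sub>v (B j *\<^sub>v z j)) $ a) \<le> (abs_mat (C j) *\<^sub>v (c \<cdot>\<^sub>v (abs_mat (B j) *\<^sub>v v))) $ a"
        using Bz Bj zj Bv by (intro norm_mult_mat_vec_le[OF Cj _ _ _ a]) auto
      then have Cz: "norm ((C j *\<^sub>v (B j *\<^sub>v z j)) $ a) \<le> c * (abs_mat (C j) *\<^sub>v (abs_mat (B j) *\<^sub>v v)) $ a"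
        unfolding mult_mat_vec[OF aC Bv] using aC a by simp
      have "(IG j - ?Mi * schur_mat (AII j) (AIG j) (AGI j) (AGG j)) *\<^sub>v z j = F j *\<^sub>v z j + C j *\<^sub>v (B j *\<^sub>v z j)"
        unfolding F_def C_def B_def
        by (rule schur_iteration_split[OF Ai[OF j j] AIG[OF j] AGI[OF j] AGG[OF j] Mi IG[OF j] zj])
      then show ?thesis
        using norm_triangle_ineq[of "(F j *\<^sub>v z j) $ a" "(C j *\<^sub>v (B j *\<^sub>v z j)) $ a"] Fz Cz a Cj
        by (simp add: distrib_left del: index_mult_mat_vec)
    qed
    then have "norm (\<Sum>j\<in>?J. ((IG j - ?Mi * schur_mat (AII j) (AIG j) (AGI j) (AGG j)) *\<^sub>v z j) $ a) \<le>
        (\<Sum>j\<in>?J. c * ((abs_mat (C j) *\<^sub>v (abs_mat (B j) *\<^sub>v v)) $ a + (abs_mat (F j) *\<^sub>v v) $ a))"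
      by (rule sum_norm_le)
    also have "\<dots> \<le> c * (\<gamma> * v $ a)"
      unfolding sum_distrib_left[symmetric] by (intro mult_left_mono weight a c)
    finally show "norm (\<Sum>j\<in>?J. ((IG j - ?Mi * schur_mat (AII j) (AIG j) (AGI j) (AGG j)) *\<^sub>v z j) $ a)
        \<le> \<gamma> * c * v $ a" by (simp add: ac_simps)
  qed
qed

end
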